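(* Let $0<r<\infty$ and let $X_t$ be the nonisotropic tempered $\alpha$-stable process in $\mathbb{R}^d$ with $\alpha\in(0,1)\cup(1,2)$ and tempering parameter $\lambda>0$, started at a point of $B(0,r)$. If $\beta\le\lambda$, then $$\mathrm{E}\left[\exp\left(\beta\left|X_{\tau_{B(0,r)}}\right|\right)\right]<\infty .$$
   Context: The nonisotropic (anisotropic) tempered $\alpha$-stable process is the Lévy process (started at $X_0$) with $\mathrm{E}[e^{ik\cdot (X_t-X_0)}]=e^{t\psi(k)}$, where for $0<\alpha<1$ $$\psi(k)=c_{m,\alpha}\int_{\mathbb{R}^d\setminus\{0\}}\left(e^{ik\cdot y}-1\right)\frac{m(y)}{e^{\lambda|y|}|y|^{d+\alpha}}\,dy,$$ and for $1<\alpha<2$ $$\psi(k)=c_{m,\alpha}\int_{\mathbb{R}^d\setminus\{0\}}\left(e^{ik\cdot y}-1-i(k\cdot y)\mathbf 1_{\{|y|<1\}}\right)\frac{m(y)}{e^{\lambda|y|}|y|^{d+\alpha}}\,dy+c_{m,\alpha}\Gamma(1-\alpha)\lambda^{\alpha-1}\,i(\mathbf b\cdot k).$$ Here $m$ is a probability density on the unit sphere (the distribution of the spreading direction), $m(y)$ means $m(y/|y|)$, $\mathbf b=\int_{|\phi|=1}\phi\, m(\phi)\,d\phi$, and $c_{m,\alpha}>0$ is a normalizing constant. $B(0,r)=\{y\in\mathbb{R}^d:|y|\le r\}$ and $\tau_{B(0,r)}=\inf\{t>0:X_t\notin B(0,r)\}$. *)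

theory Defs
  imports "HOL-Probability.Probability"
begin

text \<open>
  Surface measure on the unit sphere, as the cone measure: the surface area of a Borel set
  \<open>A\<close> of unit vectors is \<open>d\<close> times the volume of the cone
  \<open>{s *\<^sub>R \<phi> | s \<phi>. 0 < s \<le> 1 \<and> \<phi> \<in> A}\<close>.  For \<open>d = 1\<close> this is counting measure on the two unit
  vectors.
\<close>

definition sphere_measure :: "'a::euclidean_space measure" where
  "sphere_measure =
     scale_measure (of_nat DIM('a))
       (distr (restrict_space lborel (cball 0 1 - {0})) (restrict_space borel (sphere 0 1)) sgn)"

definition sphere_prob_density :: "('a::euclidean_space \<Rightarrow> real) \<Rightarrow> bool" where
  "sphere_prob_density m \<longleftrightarrow>
     m \<in> borel_measurable (restrict_space borel (sphere 0 1)) \<and>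
     (\<forall>\<phi>\<in>sphere 0 1. 0 \<le> m \<phi>) \<and>
     has_bochner_integral sphere_measure m 1"

definition sphere_mean :: "('a::euclidean_space \<Rightarrow> real) \<Rightarrow> 'a" where
  "sphere_mean m = (LINT \<phi>|sphere_measure. m \<phi> *\<^sub>R \<phi>)"

definition tempered_stable_density ::
  "('a::euclidean_space \<Rightarrow> real) \<Rightarrow> real \<Rightarrow> real \<Rightarrow> 'a \<Rightarrow> real" where
  "tempered_stable_density m \<alpha> lam y =
     m (sgn y) / (exp (lam * norm y) * norm y powr (real DIM('a) + \<alpha>))"

text \<open>
  The exponent \<open>\<psi>\<close>; the two branches are meant for \<open>0 < \<alpha> < 1\<close> and \<open>1 < \<alpha> < 2\<close> respectively.
\<close>

definition tempered_stable_exponent ::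
  "('a::euclidean_space \<Rightarrow> real) \<Rightarrow> real \<Rightarrow> real \<Rightarrow> real \<Rightarrow> 'a \<Rightarrow> complex" where
  "tempered_stable_exponent m c \<alpha> lam k =
     (if \<alpha> < 1 then
        of_real c *
          (LINT y:-{0}|lborel.
             (iexp (k \<bullet> y) - 1) * of_real (tempered_stable_density m \<alpha> lam y))
      else
        of_real c *
          (LINT y:-{0}|lborel.
             (iexp (k \<bullet> y) - 1 - \<i> * of_real ((k \<bullet> y) * indicator {y. norm y < 1} y)) *
               of_real (tempered_stable_density m \<alpha> lam y))
        + of_real (c * Gamma (1 - \<alpha>) * lam powr (\<alpha> - 1)) * \<i> * of_real (sphere_mean m \<bullet> k))"

definition cadlag :: "(real \<Rightarrow> 'a::topological_space) \<Rightarrow> bool" where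
  "cadlag f \<longleftrightarrow>
     (\<forall>t\<ge>0. (f \<longlongrightarrow> f t) (at_right t)) \<and> (\<forall>t>0. \<exists>l. (f \<longlongrightarrow> l) (at_left t))"

text \<open>
  Levy process started at the point \<open>x\<close>; the values \<open>X t\<close> for \<open>t < 0\<close> are irrelevant.
  Continuity in probability is not assumed separately: it follows from stationarity and
  almost sure right continuity at time 0.
\<close>

locale levy_process = prob_space M
  for M :: "'w measure" and X :: "real \<Rightarrow> 'w \<Rightarrow> 'a::euclidean_space" and x :: 'a +
  assumes random_variable_X: "0 \<le> t \<Longrightarrow> random_variable borel (X t)"
    and start: "AE \<omega> in M. X 0 \<omega> = x"
    and independent_increments:
      "\<lbrakk>0 \<le> u 0; mono u\<rbrakk> \<Longrightarrow>
         indep_vars (\<lambda>_. borel) (\<lambda>i \<omega>. X (u (Suc i)) \<omega> - X (u i) \<omega>) {..<n::nat}"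
    and stationary_increments:
      "\<lbrakk>0 \<le> s; 0 \<le> t\<rbrakk> \<Longrightarrow>
         distr M borel (\<lambda>\<omega>. X (s + t) \<omega> - X s \<omega>) = distr M borel (\<lambda>\<omega>. X t \<omega> - X 0 \<omega>)"
    and cadlag_paths: "AE \<omega> in M. cadlag (\<lambda>t. X t \<omega>)"

locale tempered_stable_process = levy_process M X x
  for M :: "'w measure" and X :: "real \<Rightarrow> 'w \<Rightarrow> 'a::euclidean_space" and x :: 'a +
  fixes m :: "'a \<Rightarrow> real" and c \<alpha> lam :: real
  assumes characteristic_function:
    "0 \<le> t \<Longrightarrow>
       expectation (\<lambda>\<omega>. iexp (k \<bullet> (X t \<omega> - X 0 \<omega>))) =
         exp (of_real t * tempered_stable_exponent m c \<alpha> lam k)"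

definition exit_time :: "(real \<Rightarrow> 'w \<Rightarrow> 'a) \<Rightarrow> 'a set \<Rightarrow> 'w \<Rightarrow> ereal" where
  "exit_time X B \<omega> = Inf {ereal t | t. 0 < t \<and> X t \<omega> \<notin> B}"

text \<open>
  The position at the exit time.  Where the exit time is \<open>\<infinity>\<close>, \<open>real_of_ereal\<close> makes this
  \<open>X 0\<close>, so it is meaningful only together with almost sure finiteness of the exit time.
\<close>

definition exit_position :: "(real \<Rightarrow> 'w \<Rightarrow> 'a) \<Rightarrow> 'a set \<Rightarrow> 'w \<Rightarrow> 'a" where
  "exit_position X B \<omega> = X (real_of_ereal (exit_time X B \<omega>)) \<omega>"

end

theory Submission
  imports Defs
begin

text \<open>
  Write \<open>g x = exp (lam * |x|)\<close> and \<open>\<nu>\<close> for the jump measure, whose density is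
  \<open>c * tempered_stable_density m \<alpha> lam\<close>.  The tempering factor cancels \<open>g\<close> exactly, and what remains,
  \<open>m (y / |y|) / |y| powr (d + \<alpha>)\<close>, is integrable at infinity.  So \<open>\<nu>\<close> integrates \<open>g\<close> away from the
  origin, and the critical exponent \<open>\<beta> = lam\<close> is admissible.  Two facts about the increments of the
  process carry the proof; the rest needs only independent and stationary increments and right
  continuity of the paths.

  \<^item> \<open>E[g (X\<^sub>t - X\<^sub>0)]\<close> is bounded for \<open>t \<le> T\<close> (\<open>exp_moment\<close>).  The characteristic function at time \<open>t\<close>
    is the limit of those of random walks whose steps are truncated, compensated jumps.  One step
    multiplies the mean of \<open>exp (lam * sqrt (1 + |x|\<^sup>2))\<close> by at most \<open>exp (C * d)\<close>, where \<open>d\<close> is the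
    length of the time step and \<open>C\<close> does not depend on the truncation (\<open>nn_integral_step_le\<close>).  The bound
    passes to the limit by a Gaussian smoothing (\<open>nn_integral_le_of_tendsto_char\<close>).

  \<^item> For a suitable \<open>T\<close>, the event \<open>|X\<^sub>T - X\<^sub>0| \<le> 2 * r\<close> has a probability \<open>q < 1\<close>, since the
    characteristic function at a small frequency decays exponentially in time
    (\<open>ex_time_not_confined\<close>).

  On a grid with \<open>L\<close> points in each interval of length \<open>T\<close>, the walk survives \<open>n\<close> intervals inside the
  ball with probability at most \<open>q ^ n\<close>.  If it leaves the ball during the next interval, then the
  position at the exit is comparable, in the mean of \<open>g\<close>, with the position at the end of the interval,
  because the increment in between is independent of the exit and does not decrease \<open>g\<close> by more than a
  constant factor in the mean.  The resulting geometric series bounds the moment of the exit position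
  on the grid, uniformly in \<open>L\<close> (\<open>exit_moment\<close>).  By right continuity of the paths the exit positions on the
  grids converge to \<open>exit_position\<close>, and Fatou's lemma gives the theorem.
\<close>

lemma sets_borel_balls [measurable]:
  "ball x r \<in> sets borel" "cball x r \<in> sets borel" for x :: "'a::euclidean_space"
  by simp_all

section \<open>Random walks with lazy steps\<close>

text \<open>
  The law of a lazy step: the shift \<open>s\<close> always occurs, and with probability \<open>p\<close> an independent jump
  with law \<open>Q\<close> is added to it.
\<close>

definition lazy_step :: "real \<Rightarrow> 'a::euclidean_space measure \<Rightarrow> 'a \<Rightarrow> 'a measure" where
  "lazy_step p Q s =
     distr (measure_pmf (bernoulli_pmf p) \<Otimes>\<^sub>M Q) borel (\<lambda>(b, y). s + (if b then y else 0))"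

text \<open>
  The \<open>n\<close>-fold convolution power of \<open>\<rho>\<close>, that is, the law of a random walk from \<open>0\<close> after \<open>n\<close> steps.
\<close>

primrec walk_law :: "'a::euclidean_space measure \<Rightarrow> nat \<Rightarrow> 'a measure" where
  "walk_law \<rho> 0 = return borel 0"
| "walk_law \<rho> (Suc n) = distr (\<rho> \<Otimes>\<^sub>M walk_law \<rho> n) borel (\<lambda>(x, y). x + y)"

lemma sets_lazy_step [simp, measurable_cong]: "sets (lazy_step p Q s) = sets borel"
  by (simp add: lazy_step_def)

lemma sets_walk_law [simp, measurable_cong]: "sets (walk_law \<rho> n) = sets borel"
  by (cases n) auto

context
  fixes Q :: "'a::euclidean_space measure" and p :: real and s :: 'a
  assumes Q: "prob_space Q" and sets_Q [simp, measurable_cong]: "sets Q = sets borel"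
    and p: "0 \<le> p" "p \<le> 1"
begin

interpretation Q: prob_space Q by (rule Q)

interpretation BQ: pair_prob_space "measure_pmf (bernoulli_pmf p)" Q ..

lemma prob_space_lazy_step: "prob_space (lazy_step p Q s)"
  unfolding lazy_step_def by (rule BQ.prob_space_distr) measurable

lemma nn_integral_lazy_step:
  assumes [measurable]: "f \<in> borel_measurable borel"
  shows "(\<integral>\<^sup>+x. f x \<partial>lazy_step p Q s) =
           ennreal p * (\<integral>\<^sup>+y. f (s + y) \<partial>Q) + ennreal (1 - p) * f s"
proof -
  have "(\<integral>\<^sup>+x. f x \<partial>lazy_step p Q s) =
        (\<integral>\<^sup>+z. f (case z of (b, y) \<Rightarrow> s + (if b then y else 0)) \<partial>(measure_pmf (bernoulli_pmf p) \<Otimes>\<^sub>M Q))"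
    unfolding lazy_step_def by (subst nn_integral_distr) auto
  also have "\<dots> = (\<integral>\<^sup>+b. \<integral>\<^sup>+y. f (s + (if b then y else 0)) \<partial>Q \<partial>measure_pmf (bernoulli_pmf p))"
    by (subst Q.nn_integral_fst[symmetric]) auto
  also have "\<dots> = ennreal p * (\<integral>\<^sup>+y. f (s + y) \<partial>Q) + ennreal (1 - p) * f s"
    using p by (simp add: Q.emeasure_space_1 mult.commute)
  finally show ?thesis .
qed

lemma integral_lazy_step:
  fixes f :: "'a \<Rightarrow> complex"
  assumes f [measurable]: "f \<in> borel_measurable borel" and B: "\<And>x. norm (f x) \<le> B"
  shows "(\<integral>x. f x \<partial>lazy_step p Q s) =
           of_real p * (\<integral>y. f (s + y) \<partial>Q) + of_real (1 - p) * f s"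
proof -
  have "(\<integral>x. f x \<partial>lazy_step p Q s) =
        (\<integral>z. f (case z of (b, y) \<Rightarrow> s + (if b then y else 0)) \<partial>(measure_pmf (bernoulli_pmf p) \<Otimes>\<^sub>M Q))"
    unfolding lazy_step_def by (subst integral_distr) auto
  also have "\<dots> = (\<integral>b. \<integral>y. f (s + (if b then y else 0)) \<partial>Q \<partial>measure_pmf (bernoulli_pmf p))"
    by (subst BQ.integral_fst'[symmetric])
      (auto intro!: BQ.integrable_const_bound[where B = B] B simp: case_prod_beta'
        cong: if_cong)
  also have "\<dots> = of_real p * (\<integral>y. f (s + y) \<partial>Q) + of_real (1 - p) * f s"
    using p by (subst integral_measure_pmf[of UNIV])
      (auto simp: UNIV_bool Q.prob_space scaleR_conv_of_real)
  finally show ?thesis .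
qed

end

context
  fixes \<rho> :: "'a::euclidean_space measure"
  assumes \<rho>: "prob_space \<rho>" and sets_\<rho> [simp, measurable_cong]: "sets \<rho> = sets borel"
begin

interpretation \<rho>: prob_space \<rho> by (rule \<rho>)

lemma prob_space_walk_law: "prob_space (walk_law \<rho> n)"
proof (induction n)
  case 0
  show ?case by (simp add: prob_space_return)
next
  case (Suc n)
  interpret W: prob_space "walk_law \<rho> n" by (rule Suc)
  interpret pair_prob_space \<rho> "walk_law \<rho> n" ..
  show ?case by (simp, rule prob_space_distr) measurable
qed

lemma nn_integral_walk_law_Suc:
  assumes [measurable]: "f \<in> borel_measurable borel"
  shows "(\<integral>\<^sup>+x. f x \<partial>walk_law \<rho> (Suc n)) = (\<integral>\<^sup>+y. \<integral>\<^sup>+x. f (y + x) \<partial>\<rho> \<partial>walk_law \<rho> n)"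
proof -
  interpret W: prob_space "walk_law \<rho> n" by (rule prob_space_walk_law)
  interpret P: pair_prob_space \<rho> "walk_law \<rho> n" ..
  have "(\<integral>\<^sup>+x. f x \<partial>walk_law \<rho> (Suc n)) = (\<integral>\<^sup>+z. f (case z of (x, y) \<Rightarrow> x + y) \<partial>(\<rho> \<Otimes>\<^sub>M walk_law \<rho> n))"
    by (simp, subst nn_integral_distr) auto
  also have "\<dots> = (\<integral>\<^sup>+y. \<integral>\<^sup>+x. f (x + y) \<partial>\<rho> \<partial>walk_law \<rho> n)"
    by (subst P.nn_integral_snd[symmetric]) (auto simp: case_prod_beta')
  finally show ?thesis by (simp add: add.commute)
qed

text \<open>
  A function that one step multiplies by at most \<open>C\<close> in the mean is multiplied by at most \<open>C ^ n\<close> by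
  \<open>n\<close> steps.
\<close>

lemma nn_integral_walk_law_le:
  assumes [measurable]: "g \<in> borel_measurable borel"
    and step: "\<And>y. (\<integral>\<^sup>+x. g (y + x) \<partial>\<rho>) \<le> C * g y"
  shows "(\<integral>\<^sup>+x. g x \<partial>walk_law \<rho> n) \<le> C ^ n * g 0"
proof (induction n)
  case 0
  show ?case by (simp add: nn_integral_return)
next
  case (Suc n)
  have "(\<integral>\<^sup>+x. g x \<partial>walk_law \<rho> (Suc n)) \<le> (\<integral>\<^sup>+y. C * g y \<partial>walk_law \<rho> n)"
    by (subst nn_integral_walk_law_Suc) (auto intro!: nn_integral_mono step)
  also have "\<dots> = C * (\<integral>\<^sup>+y. g y \<partial>walk_law \<rho> n)"
    by (rule nn_integral_cmult) auto
  also have "\<dots> \<le> C * (C ^ n * g 0)"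
    by (intro mult_left_mono Suc) auto
  finally show ?case by (simp add: mult.assoc)
qed

lemma char_walk_law:
  "(\<integral>x. iexp (k \<bullet> x) \<partial>walk_law \<rho> n) = (\<integral>x. iexp (k \<bullet> x) \<partial>\<rho>) ^ n"
proof (induction n)
  case 0
  show ?case by (simp add: integral_return)
next
  case (Suc n)
  interpret W: prob_space "walk_law \<rho> n" by (rule prob_space_walk_law)
  interpret P: pair_prob_space \<rho> "walk_law \<rho> n" ..
  have "(\<integral>x. iexp (k \<bullet> x) \<partial>walk_law \<rho> (Suc n)) =
        (\<integral>z. iexp (k \<bullet> fst z) * iexp (k \<bullet> snd z) \<partial>(\<rho> \<Otimes>\<^sub>M walk_law \<rho> n))"
    by (simp, subst integral_distr) (auto simp: case_prod_beta' inner_add_right exp_add algebra_simps)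
  also have "\<dots> = (\<integral>x. \<integral>y. iexp (k \<bullet> x) * iexp (k \<bullet> y) \<partial>walk_law \<rho> n \<partial>\<rho>)"
    by (subst P.integral_fst'[symmetric])
      (auto intro!: P.integrable_const_bound[where B = 1] simp: norm_mult)
  also have "\<dots> = (\<integral>x. iexp (k \<bullet> x) \<partial>\<rho>) ^ Suc n"
    by (simp add: Suc)
  finally show ?case .
qed

end

section \<open>Gaussian smoothing and moments\<close>

text \<open>
  The standard Gaussian measure, as a product over the coordinates.  Only its characteristic function is
  needed: it shows that the kernel \<open>exp (- |w|\<^sup>2 / 2)\<close> is the Fourier transform of a probability
  measure.
\<close>

definition gauss_measure :: "'a::euclidean_space measure" where
  "gauss_measure = distr (\<Pi>\<^sub>M i\<in>Basis. std_normal_distribution) borel (\<lambda>f. \<Sum>i\<in>Basis. f i *\<^sub>R i)"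

lemma sets_gauss_measure [simp, measurable_cong]: "sets gauss_measure = sets borel"
  by (simp add: gauss_measure_def)

lemma prob_space_gauss_measure: "prob_space (gauss_measure :: 'a::euclidean_space measure)"
proof -
  interpret S: prob_space std_normal_distribution by (rule prob_space_normal_density) simp
  interpret P: product_prob_space "\<lambda>i::'a. std_normal_distribution" ..
  have "prob_space (\<Pi>\<^sub>M i\<in>(Basis::'a set). std_normal_distribution)"
    by (rule prob_space_PiM) (rule S.prob_space_axioms)
  then show ?thesis
    unfolding gauss_measure_def by (rule prob_space.prob_space_distr) measurable
qed

lemma char_gauss_measure:
  "(\<integral>k. iexp (w \<bullet> k) \<partial>gauss_measure) = of_real (exp (- (norm w)\<^sup>2 / 2))"
  for w :: "'a::euclidean_space"
proof -
  interpret S: prob_space std_normal_distribution by (rule prob_space_normal_density) simp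
  interpret P: product_prob_space "\<lambda>i::'a. std_normal_distribution" ..
  have norm_w: "(norm w)\<^sup>2 = (\<Sum>i\<in>Basis. (w \<bullet> i)\<^sup>2)"
    unfolding power2_norm_eq_inner by (subst euclidean_inner) (simp add: power2_eq_square)
  have "(\<integral>k. iexp (w \<bullet> k) \<partial>gauss_measure) =
     (\<integral>f. (\<Prod>i\<in>Basis. iexp ((w \<bullet> i) * f i)) \<partial>(\<Pi>\<^sub>M i\<in>Basis. std_normal_distribution))"
    unfolding gauss_measure_def
    by (subst integral_distr)
      (auto simp: inner_sum_right exp_sum[symmetric] sum_distrib_left algebra_simps)
  also have "\<dots> = (\<Prod>i\<in>Basis. (\<integral>x. iexp ((w \<bullet> i) * x) \<partial>std_normal_distribution))"
    by (rule P.product_integral_prod) (auto intro!: S.integrable_const_bound[where B = 1])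
  also have "\<dots> = (\<Prod>i\<in>Basis. of_real (exp (- ((w \<bullet> i)\<^sup>2) / 2)))"
    using char_std_normal_distribution by (simp add: char_def fun_eq_iff)
  also have "\<dots> = of_real (exp (- (norm w)\<^sup>2 / 2))"
    by (simp add: of_real_prod[symmetric] exp_sum[symmetric] sum_negf
        sum_divide_distrib[symmetric] norm_w del: of_real_prod)
  finally show ?thesis .
qed

text \<open>
  Convergence of characteristic functions implies convergence of the measures smoothed by a Gaussian
  kernel: by Fubini the smoothed mass at \<open>z\<close> is a Gaussian average of the characteristic function,
  which is bounded by \<open>1\<close>.  Tightness plays no role.
\<close>

lemma tendsto_smoothed:
  fixes \<mu> :: "'a::euclidean_space measure" and \<mu>s :: "nat \<Rightarrow> 'a measure"
  assumes \<mu>: "prob_space \<mu>" and sets_\<mu> [simp, measurable_cong]: "sets \<mu> = sets borel"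
    and \<mu>s: "\<And>j. prob_space (\<mu>s j)" and sets_\<mu>s [simp, measurable_cong]: "\<And>j. sets (\<mu>s j) = sets borel"
    and conv: "\<And>k. (\<lambda>j. \<integral>x. iexp (k \<bullet> x) \<partial>\<mu>s j) \<longlonglongrightarrow> (\<integral>x. iexp (k \<bullet> x) \<partial>\<mu>)"
  shows "(\<lambda>j. \<integral>\<^sup>+x. ennreal (exp (- (norm (x - z))\<^sup>2 / 2)) \<partial>\<mu>s j)
           \<longlonglongrightarrow> (\<integral>\<^sup>+x. ennreal (exp (- (norm (x - z))\<^sup>2 / 2)) \<partial>\<mu>)"
proof -
  interpret \<gamma>: prob_space "gauss_measure :: 'a measure" by (rule prob_space_gauss_measure)
  have fourier: "of_real (\<integral>x. exp (- (norm (x - z))\<^sup>2 / 2) \<partial>N) =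
      (\<integral>k. iexp (- (k \<bullet> z)) * (\<integral>x. iexp (k \<bullet> x) \<partial>N) \<partial>gauss_measure)"
    if N: "prob_space N" and [simp, measurable_cong]: "sets N = sets borel" for N :: "'a measure"
  proof -
    interpret N: prob_space N by (rule N)
    interpret P: pair_prob_space N "gauss_measure :: 'a measure" ..
    have "of_real (\<integral>x. exp (- (norm (x - z))\<^sup>2 / 2) \<partial>N) =
          (\<integral>x. \<integral>k. iexp ((x - z) \<bullet> k) \<partial>gauss_measure \<partial>N)"
      by (simp add: char_gauss_measure flip: integral_complex_of_real)
    also have "\<dots> = (\<integral>k. \<integral>x. iexp ((x - z) \<bullet> k) \<partial>N \<partial>gauss_measure)"
      by (rule P.Fubini_integral[symmetric])
        (auto intro!: P.integrable_const_bound[where B = 1] simp: case_prod_beta')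
    also have "\<dots> = (\<integral>k. iexp (- (k \<bullet> z)) * (\<integral>x. iexp (k \<bullet> x) \<partial>N) \<partial>gauss_measure)"
      by (simp add: inner_diff_left inner_diff_right inner_commute exp_diff right_diff_distrib exp_minus field_simps
          flip: integral_mult_right_zero)
    finally show ?thesis .
  qed
  have char_le: "norm (\<integral>x. iexp (k \<bullet> x) \<partial>\<mu>s j) \<le> 1" for j k
  proof -
    interpret N: prob_space "\<mu>s j" by (rule \<mu>s)
    have "norm (\<integral>x. iexp (k \<bullet> x) \<partial>\<mu>s j) \<le> (\<integral>x. norm (iexp (k \<bullet> x)) \<partial>\<mu>s j)"
      by (rule integral_norm_bound)
    then show ?thesis by (simp add: N.prob_space)
  qed
  have meas: "(\<lambda>k. \<integral>x. iexp (k \<bullet> x) \<partial>N) \<in> borel_measurable borel"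
    if N: "prob_space N" and [simp, measurable_cong]: "sets N = sets borel" for N :: "'a measure"
  proof -
    interpret N: prob_space N by (rule N)
    show ?thesis by measurable
  qed
  note [measurable] = meas[OF \<mu>s] meas[OF \<mu>]
  have "(\<lambda>j. complex_of_real (\<integral>x. exp (- (norm (x - z))\<^sup>2 / 2) \<partial>\<mu>s j))
     \<longlonglongrightarrow> complex_of_real (\<integral>x. exp (- (norm (x - z))\<^sup>2 / 2) \<partial>\<mu>)"
    unfolding fourier[OF \<mu>s sets_\<mu>s] fourier[OF \<mu> sets_\<mu>]
    by (rule integral_dominated_convergence[where w = "\<lambda>_. 1"])
      (auto intro!: tendsto_intros conv simp: norm_mult char_le)
  then have "(\<lambda>j. (\<integral>x. exp (- (norm (x - z))\<^sup>2 / 2) \<partial>\<mu>s j))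
     \<longlonglongrightarrow> (\<integral>x. exp (- (norm (x - z))\<^sup>2 / 2) \<partial>\<mu>)"
    by (simp only: tendsto_of_real_iff)
  moreover have "(\<integral>\<^sup>+x. ennreal (exp (- (norm (x - z))\<^sup>2 / 2)) \<partial>N) =
       ennreal (\<integral>x. exp (- (norm (x - z))\<^sup>2 / 2) \<partial>N)"
    if N: "prob_space N" and [simp, measurable_cong]: "sets N = sets borel" for N :: "'a measure"
  proof -
    interpret N: prob_space N by (rule N)
    show ?thesis
      by (rule nn_integral_eq_integral) (auto intro!: N.integrable_const_bound[where B = 1])
  qed
  ultimately show ?thesis using \<mu> \<mu>s by (simp add: tendsto_ennrealI)
qed

lemma nn_integral_exp_norm_gauss_finite:
  "(\<integral>\<^sup>+(w::'a::euclidean_space). ennreal (exp (lam * norm w) * exp (- (norm w)\<^sup>2 / 2)) \<partial>lborel) < \<infinity>"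
  if lam: "0 \<le> lam"
proof -
  have fin1: "(\<integral>\<^sup>+(x::real). ennreal (exp (lam * \<bar>x\<bar>) * exp (- x\<^sup>2 / 2)) \<partial>lborel) < \<infinity>"
  proof -
    have "(\<integral>\<^sup>+(x::real). ennreal (exp (lam * \<bar>x\<bar>) * exp (- x\<^sup>2 / 2)) \<partial>lborel) \<le>
          (\<integral>\<^sup>+(x::real). ennreal (exp (lam\<^sup>2) * sqrt (4 * pi)) * ennreal (normal_density 0 (sqrt 2) x) \<partial>lborel)"
    proof (intro nn_integral_mono)
      fix x :: real
      \<comment> \<open>completing the square: half of the Gaussian exponent absorbs the linear term\<close>
      have "lam * \<bar>x\<bar> \<le> lam\<^sup>2 + x\<^sup>2 / 4"
        using zero_le_power2[of "lam - \<bar>x\<bar> / 2"] by (simp add: power2_diff power_divide)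
      then have "exp (lam * \<bar>x\<bar>) * exp (- x\<^sup>2 / 2) \<le> exp (lam\<^sup>2) * exp (- x\<^sup>2 / 4)"
        unfolding exp_add[symmetric] by simp
      also have "\<dots> = exp (lam\<^sup>2) * sqrt (4 * pi) * normal_density 0 (sqrt 2) x"
        by (simp add: normal_density_def)
      finally show "ennreal (exp (lam * \<bar>x\<bar>) * exp (- x\<^sup>2 / 2)) \<le>
          ennreal (exp (lam\<^sup>2) * sqrt (4 * pi)) * ennreal (normal_density 0 (sqrt 2) x)"
        by (simp add: ennreal_mult[symmetric] normal_density_nonneg ennreal_leI)
    qed
    also have "\<dots> < \<infinity>"
      using nn_integral_eq_integral[OF integrable_normal_density, of "sqrt 2" 0]
      by (subst nn_integral_cmult) (auto simp: normal_density_nonneg ennreal_mult_less_top)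
    finally show ?thesis .
  qed
  have "(\<integral>\<^sup>+(w::'a). ennreal (exp (lam * norm w) * exp (- (norm w)\<^sup>2 / 2)) \<partial>lborel) \<le>
     (\<integral>\<^sup>+(w::'a). (\<Prod>i\<in>Basis. ennreal (exp (lam * \<bar>w \<bullet> i\<bar>) * exp (- (w \<bullet> i)\<^sup>2 / 2))) \<partial>lborel)"
  proof (intro nn_integral_mono)
    fix w :: 'a
    have norm_w: "(norm w)\<^sup>2 = (\<Sum>i\<in>Basis. (w \<bullet> i)\<^sup>2)"
      unfolding power2_norm_eq_inner by (subst euclidean_inner) (simp add: power2_eq_square)
    have "lam * norm w \<le> (\<Sum>i\<in>Basis. lam * \<bar>w \<bullet> i\<bar>)"
      unfolding sum_distrib_left[symmetric] using lam by (intro mult_left_mono norm_le_l1) auto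
    then have "exp (lam * norm w) * exp (- (norm w)\<^sup>2 / 2) \<le>
        (\<Prod>i\<in>Basis. exp (lam * \<bar>w \<bullet> i\<bar>) * exp (- (w \<bullet> i)\<^sup>2 / 2))"
      unfolding exp_add[symmetric]
      by (simp add: exp_sum[symmetric] norm_w sum.distrib sum_subtractf sum_negf sum_divide_distrib)
    then show "ennreal (exp (lam * norm w) * exp (- (norm w)\<^sup>2 / 2)) \<le>
        (\<Prod>i\<in>Basis. ennreal (exp (lam * \<bar>w \<bullet> i\<bar>) * exp (- (w \<bullet> i)\<^sup>2 / 2)))"
      by (subst prod_ennreal) (auto intro!: ennreal_leI)
  qed
  also have "\<dots> = (\<Prod>i\<in>(Basis::'a set). (\<integral>\<^sup>+x. ennreal (exp (lam * \<bar>x\<bar>) * exp (- x\<^sup>2 / 2)) \<partial>lborel))"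
    by (rule nn_integral_lborel_prod[where f = "\<lambda>_ x. ennreal (exp (lam * \<bar>x\<bar>) * exp (- x\<^sup>2 / 2))"]) auto
  also have "\<dots> < \<infinity>"
    using fin1 by (simp add: power_less_top_ennreal)
  finally show ?thesis .
qed

text \<open>
  A form of Fatou's lemma for convergence of characteristic functions and for functions \<open>g\<close> that are
  unbounded but grow at most by the factor \<open>exp (lam * |w|)\<close> under a translation by \<open>w\<close>.  Such a
  function is comparable with its convolution with a Gaussian kernel, and the integral of the
  convolution is an integral over \<open>z\<close> of smoothed masses, to which Fatou's lemma applies.  The
  constant depends only on \<open>lam\<close> and the dimension.
\<close>

lemma nn_integral_le_of_tendsto_char:
  fixes lam :: real
  assumes lam: "0 \<le> lam"
  obtains K :: real where "0 \<le> K"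
    "\<And>(\<mu> :: 'a::euclidean_space measure) \<mu>s (g :: 'a \<Rightarrow> real) L.
      prob_space \<mu> \<Longrightarrow> sets \<mu> = sets borel \<Longrightarrow>
      (\<And>j::nat. prob_space (\<mu>s j)) \<Longrightarrow> (\<And>j. sets (\<mu>s j) = sets borel) \<Longrightarrow>
      (\<And>k. (\<lambda>j. \<integral>x. iexp (k \<bullet> x) \<partial>\<mu>s j) \<longlonglongrightarrow> (\<integral>x. iexp (k \<bullet> x) \<partial>\<mu>)) \<Longrightarrow>
      g \<in> borel_measurable borel \<Longrightarrow> (\<And>x. 0 \<le> g x) \<Longrightarrow>
      (\<And>x w. g (x + w) \<le> g x * exp (lam * norm w)) \<Longrightarrow>
      (\<And>j. (\<integral>\<^sup>+x. g x \<partial>\<mu>s j) \<le> L) \<Longrightarrow> (\<integral>\<^sup>+x. g x \<partial>\<mu>) \<le> ennreal K * L"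
proof -
  define \<kappa> :: "'a \<Rightarrow> real" where "\<kappa> w = exp (- (norm w)\<^sup>2 / 2)" for w
  have [measurable]: "\<kappa> \<in> borel_measurable borel" unfolding \<kappa>_def by measurable
  have \<kappa>_pos: "0 < \<kappa> w" for w by (simp add: \<kappa>_def)
  \<comment> \<open>the constants of comparison between \<open>g\<close> and its convolution with \<open>\<kappa>\<close>\<close>
  define A where "A = (\<integral>\<^sup>+w. ennreal (exp (lam * norm w) * \<kappa> w) \<partial>lborel)"
  define B where "B = (\<integral>\<^sup>+w. ennreal (exp (- lam * norm w) * \<kappa> w) \<partial>lborel)"
  have A: "A < \<infinity>"
    unfolding A_def \<kappa>_def by (rule nn_integral_exp_norm_gauss_finite[OF lam])
  have "B \<le> A" unfolding A_def B_def
    using lam by (intro nn_integral_mono ennreal_leI mult_right_mono)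
      (auto simp: less_imp_le[OF \<kappa>_pos] mult_nonneg_nonneg intro: order_trans[of _ 0])
  have "B \<noteq> 0"
  proof
    assume "B = 0"
    then have "AE w in lborel. ennreal (exp (- lam * norm w) * \<kappa> w) = 0"
      unfolding B_def by (subst (asm) nn_integral_0_iff_AE) auto
    then have "AE w in (lborel :: 'a measure). False"
      by eventually_elim (auto simp: ennreal_eq_0_iff mult_le_0_iff \<kappa>_pos dest!: leD)
    then have "emeasure (lborel :: 'a measure) UNIV = 0"
      by (subst (asm) AE_iff_measurable[of UNIV]) auto
    then show False by (simp add: emeasure_lborel_UNIV)
  qed
  have bound: "(\<integral>\<^sup>+x. g x \<partial>\<mu>) \<le> ennreal (enn2real (A / B)) * L"
    if \<mu>: "prob_space \<mu>" and [simp, measurable_cong]: "sets \<mu> = sets borel"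
    and \<mu>s: "\<And>j. prob_space (\<mu>s j)" and [simp, measurable_cong]: "\<And>j. sets (\<mu>s j) = sets borel"
    and conv: "\<And>k. (\<lambda>j. \<integral>x. iexp (k \<bullet> x) \<partial>\<mu>s j) \<longlonglongrightarrow> (\<integral>x. iexp (k \<bullet> x) \<partial>\<mu>)"
    and [measurable]: "g \<in> borel_measurable borel" and g: "\<And>x. 0 \<le> g x"
    and gm: "\<And>x w. g (x + w) \<le> g x * exp (lam * norm w)"
    and L: "\<And>j. (\<integral>\<^sup>+x. g x \<partial>\<mu>s j) \<le> L"
    for \<mu> :: "'a measure" and \<mu>s :: "nat \<Rightarrow> 'a measure" and g :: "'a \<Rightarrow> real" and L
  proof -
    have swap: "(\<integral>\<^sup>+z. g z * (\<integral>\<^sup>+x. ennreal (\<kappa> (x - z)) \<partial>N) \<partial>lborel) =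
        (\<integral>\<^sup>+x. \<integral>\<^sup>+w. ennreal (g (x + w) * \<kappa> w) \<partial>lborel \<partial>N)"
      if N: "prob_space N" and [simp, measurable_cong]: "sets N = sets borel" for N :: "'a measure"
    proof -
      interpret N: prob_space N by (rule N)
      interpret P: pair_sigma_finite "lborel :: 'a measure" N ..
      have "(\<integral>\<^sup>+z. g z * (\<integral>\<^sup>+x. ennreal (\<kappa> (x - z)) \<partial>N) \<partial>lborel) =
          (\<integral>\<^sup>+z. (\<integral>\<^sup>+x. ennreal (g z * \<kappa> (x - z)) \<partial>N) \<partial>lborel)"
        by (simp add: ennreal_mult g less_imp_le[OF \<kappa>_pos] nn_integral_cmult)
      also have "\<dots> = (\<integral>\<^sup>+x. (\<integral>\<^sup>+z. ennreal (g z * \<kappa> (x - z)) \<partial>lborel) \<partial>N)"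
        by (rule P.Fubini'[symmetric]) measurable
      also have "\<dots> = (\<integral>\<^sup>+x. (\<integral>\<^sup>+w. ennreal (g (x + w) * \<kappa> w) \<partial>lborel) \<partial>N)"
      proof (rule nn_integral_cong)
        fix x :: 'a
        have "(\<integral>\<^sup>+z. ennreal (g z * \<kappa> (x - z)) \<partial>lborel) =
            (\<integral>\<^sup>+z. ennreal (g z * \<kappa> (x - z)) \<partial>distr lborel borel ((+) x))"
          by (simp add: lborel_distr_plus)
        also have "\<dots> = (\<integral>\<^sup>+w. ennreal (g (x + w) * \<kappa> w) \<partial>lborel)"
          by (subst nn_integral_distr) (auto simp: \<kappa>_def)
        finally show "(\<integral>\<^sup>+z. ennreal (g z * \<kappa> (x - z)) \<partial>lborel) =
            (\<integral>\<^sup>+w. ennreal (g (x + w) * \<kappa> w) \<partial>lborel)" .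
      qed
      finally show ?thesis .
    qed
    have "B * (\<integral>\<^sup>+x. g x \<partial>\<mu>) = (\<integral>\<^sup>+x. \<integral>\<^sup>+w. ennreal (g x) * ennreal (exp (- lam * norm w) * \<kappa> w) \<partial>lborel \<partial>\<mu>)"
      by (simp add: nn_integral_cmult B_def mult.commute flip: nn_integral_multc)
    also have "\<dots> \<le> (\<integral>\<^sup>+x. \<integral>\<^sup>+w. ennreal (g (x + w) * \<kappa> w) \<partial>lborel \<partial>\<mu>)"
    proof (intro nn_integral_mono)
      fix x w :: 'a
      have "g x \<le> g (x + w) * exp (lam * norm w)"
        using gm[of "x + w" "- w"] by simp
      then have "g x * exp (- lam * norm w) \<le> g (x + w)"
        by (simp add: exp_minus field_simps)
      then have "(g x * exp (- lam * norm w)) * \<kappa> w \<le> g (x + w) * \<kappa> w"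
        by (intro mult_right_mono) (auto simp: less_imp_le[OF \<kappa>_pos])
      then show "ennreal (g x) * ennreal (exp (- lam * norm w) * \<kappa> w) \<le> ennreal (g (x + w) * \<kappa> w)"
        by (simp add: g less_imp_le[OF \<kappa>_pos] ennreal_leI mult.assoc flip: ennreal_mult)
    qed
    also have "\<dots> = (\<integral>\<^sup>+z. g z * (\<integral>\<^sup>+x. ennreal (\<kappa> (x - z)) \<partial>\<mu>) \<partial>lborel)"
      using swap[OF \<mu>] by simp
    also have "\<dots> = (\<integral>\<^sup>+z. liminf (\<lambda>j. g z * (\<integral>\<^sup>+x. ennreal (\<kappa> (x - z)) \<partial>\<mu>s j)) \<partial>lborel)"
    proof (intro nn_integral_cong)
      fix z :: 'a
      have "(\<lambda>j. g z * (\<integral>\<^sup>+x. ennreal (\<kappa> (x - z)) \<partial>\<mu>s j)) \<longlonglongrightarrow> g z * (\<integral>\<^sup>+x. ennreal (\<kappa> (x - z)) \<partial>\<mu>)"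
        unfolding \<kappa>_def by (intro ennreal_tendsto_cmult tendsto_smoothed \<mu> \<mu>s conv) auto
      then show "g z * (\<integral>\<^sup>+x. ennreal (\<kappa> (x - z)) \<partial>\<mu>) =
          liminf (\<lambda>j. g z * (\<integral>\<^sup>+x. ennreal (\<kappa> (x - z)) \<partial>\<mu>s j))"
        by (intro lim_imp_Liminf[symmetric]) auto
    qed
    also have "\<dots> \<le> liminf (\<lambda>j. \<integral>\<^sup>+z. g z * (\<integral>\<^sup>+x. ennreal (\<kappa> (x - z)) \<partial>\<mu>s j) \<partial>lborel)"
    proof (rule nn_integral_liminf)
      fix j
      interpret N: prob_space "\<mu>s j" by (rule \<mu>s)
      show "(\<lambda>z. g z * (\<integral>\<^sup>+x. ennreal (\<kappa> (x - z)) \<partial>\<mu>s j)) \<in> borel_measurable lborel"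
        by measurable
    qed
    also have "\<dots> \<le> A * L"
    proof (rule Liminf_le)
      have "(\<integral>\<^sup>+z. g z * (\<integral>\<^sup>+x. ennreal (\<kappa> (x - z)) \<partial>\<mu>s j) \<partial>lborel) \<le> A * L" for j
      proof -
        have "(\<integral>\<^sup>+z. g z * (\<integral>\<^sup>+x. ennreal (\<kappa> (x - z)) \<partial>\<mu>s j) \<partial>lborel) =
          (\<integral>\<^sup>+x. \<integral>\<^sup>+w. ennreal (g (x + w) * \<kappa> w) \<partial>lborel \<partial>\<mu>s j)"
          using swap[OF \<mu>s] by simp
        also have "\<dots> \<le> (\<integral>\<^sup>+x. \<integral>\<^sup>+w. ennreal (g x) * ennreal (exp (lam * norm w) * \<kappa> w) \<partial>lborel \<partial>\<mu>s j)"
        proof (intro nn_integral_mono)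
          fix x w :: 'a
          have "g (x + w) * \<kappa> w \<le> (g x * exp (lam * norm w)) * \<kappa> w"
            by (intro mult_right_mono gm) (auto simp: less_imp_le[OF \<kappa>_pos])
          then show "ennreal (g (x + w) * \<kappa> w) \<le> ennreal (g x) * ennreal (exp (lam * norm w) * \<kappa> w)"
            by (simp add: g less_imp_le[OF \<kappa>_pos] ennreal_leI mult.assoc flip: ennreal_mult)
        qed
        also have "\<dots> = A * (\<integral>\<^sup>+x. g x \<partial>\<mu>s j)"
          by (simp add: nn_integral_cmult A_def mult.commute flip: nn_integral_multc)
        also have "\<dots> \<le> A * L" by (intro mult_left_mono L) auto
        finally show ?thesis .
      qed
      then show "\<forall>\<^sub>F j in sequentially. (\<integral>\<^sup>+z. g z * (\<integral>\<^sup>+x. ennreal (\<kappa> (x - z)) \<partial>\<mu>s j) \<partial>lborel) \<le> A * L"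
        by simp
    qed auto
    finally have *: "B * (\<integral>\<^sup>+x. g x \<partial>\<mu>) \<le> A * L" .
    have "(\<integral>\<^sup>+x. g x \<partial>\<mu>) = (B * (\<integral>\<^sup>+x. g x \<partial>\<mu>)) / B"
      using \<open>B \<noteq> 0\<close> \<open>B \<le> A\<close> A by (subst mult.commute, subst mult_divide_eq_ennreal) auto
    also have "\<dots> \<le> (A * L) / B" by (rule divide_right_mono_ennreal[OF *])
    also have "\<dots> = (A / B) * L" by (simp add: divide_ennreal_def ac_simps)
    also have "A / B = ennreal (enn2real (A / B))"
      using A \<open>B \<noteq> 0\<close> by (intro ennreal_enn2real[symmetric])
        (auto simp: divide_ennreal_def ennreal_mult_less_top ennreal_inverse_eq_top_iff less_top[symmetric] ennreal_mult_eq_top_iff)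
    finally show ?thesis .
  qed
  show thesis
    by (rule that[of "enn2real (A / B)"], simp, rule bound, assumption+)
qed

section \<open>A smooth convex substitute for the norm\<close>

text \<open>
  A smooth substitute for the norm.  It is convex and exceeds the norm by at most \<open>1\<close>; the gradient at
  \<open>x\<close> is \<open>x / smooth_norm x\<close>, of norm at most \<open>1\<close>, and the second derivative is bounded.
\<close>

definition smooth_norm :: "'a::real_inner \<Rightarrow> real" where
  "smooth_norm x = sqrt (1 + (norm x)\<^sup>2)"

lemma smooth_norm_pos: "0 < smooth_norm x" and smooth_norm_ge_1: "1 \<le> smooth_norm x"
  and smooth_norm_squared: "(smooth_norm x)\<^sup>2 = 1 + (norm x)\<^sup>2"
  and norm_le_smooth_norm: "norm x \<le> smooth_norm x"
  by (auto simp: smooth_norm_def add_pos_nonneg intro: real_le_rsqrt)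

text \<open>
  Convexity: the graph lies above the tangent plane at \<open>x\<close>.  The inequality is Cauchy--Schwarz for the
  vectors \<open>(1, x)\<close> and \<open>(1, x + y)\<close>.
\<close>

lemma smooth_norm_tangent_le: "smooth_norm x + (x \<bullet> y) / smooth_norm x \<le> smooth_norm (x + y)"
proof -
  have "1 + x \<bullet> (x + y) \<le> smooth_norm x * smooth_norm (x + y)"
  proof -
    have "x \<bullet> (x + y) \<le> norm x * norm (x + y)" by (rule norm_cauchy_schwarz)
    moreover have "(1 + norm x * norm (x + y))\<^sup>2 \<le> (1 + (norm x)\<^sup>2) * (1 + (norm (x + y))\<^sup>2)"
      using zero_le_power2[of "norm x - norm (x + y)"]
      by (simp add: power2_eq_square algebra_simps)
    then have "1 + norm x * norm (x + y) \<le> sqrt ((1 + (norm x)\<^sup>2) * (1 + (norm (x + y))\<^sup>2))"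
      by (rule real_le_rsqrt)
    ultimately show ?thesis by (simp add: smooth_norm_def real_sqrt_mult)
  qed
  also have "1 + x \<bullet> (x + y) = (smooth_norm x)\<^sup>2 + x \<bullet> y"
    by (simp add: smooth_norm_squared inner_add_right power2_norm_eq_inner)
  finally show ?thesis
    using smooth_norm_pos[of x] by (simp add: field_simps power2_eq_square)
qed

lemma smooth_norm_add_le_quadratic:
  "smooth_norm (x + y) \<le> smooth_norm x + (x \<bullet> y) / smooth_norm x + (norm y)\<^sup>2 / 2"
proof -
  define q where "q = smooth_norm x"
  have q: "1 \<le> q" "q\<^sup>2 = 1 + (norm x)\<^sup>2"
    by (simp_all add: q_def smooth_norm_ge_1 smooth_norm_squared)
  define s where "s = x \<bullet> y + (norm y)\<^sup>2 / 2"
  have e: "1 + (norm (x + y))\<^sup>2 = q\<^sup>2 + 2 * s"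
    by (simp add: q s_def power2_norm_eq_inner inner_add_left inner_add_right inner_commute)
  have "0 \<le> q\<^sup>2 + 2 * s" by (simp add: e[symmetric])
  have sq: "(q + s / q)\<^sup>2 = q\<^sup>2 + 2 * s + (s / q)\<^sup>2"
    using q(1) by (simp add: power2_sum)
  \<comment> \<open>the sign of the right-hand side is needed before squaring\<close>
  have "0 \<le> q * (q + s / q)"
  proof -
    have "q * (q + s / q) = q\<^sup>2 + s" using q by (simp add: power2_eq_square field_simps)
    moreover have "0 \<le> q\<^sup>2 + s" using \<open>0 \<le> q\<^sup>2 + 2 * s\<close> zero_le_power2[of q] by linarith
    ultimately show ?thesis by simp
  qed
  then have "0 \<le> q + s / q" using q by (simp add: zero_le_mult_iff)
  then have "sqrt (q\<^sup>2 + 2 * s) \<le> q + s / q"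
    by (intro real_le_lsqrt) (auto simp: sq)
  also have "s / q \<le> (x \<bullet> y) / q + (norm y)\<^sup>2 / 2"
  proof -
    have "(norm y)\<^sup>2 / 2 / q \<le> (norm y)\<^sup>2 / 2" using q by (simp add: divide_le_eq mult_le_cancel_left1)
    then show ?thesis by (simp add: s_def add_divide_distrib)
  qed
  finally show ?thesis by (simp add: smooth_norm_def[of "x + y"] e q_def[symmetric])
qed

lemma abs_inner_div_smooth_norm_le: "\<bar>(x \<bullet> y) / smooth_norm x\<bar> \<le> norm y"
proof -
  have "\<bar>x \<bullet> y\<bar> \<le> norm x * norm y" by (rule Cauchy_Schwarz_ineq2)
  also have "\<dots> \<le> smooth_norm x * norm y" by (intro mult_right_mono norm_le_smooth_norm) auto
  finally show ?thesis using smooth_norm_pos[of x] by (simp add: abs_divide field_simps)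
qed

lemma smooth_norm_add_le: "smooth_norm (x + y) \<le> smooth_norm x + norm y"
proof -
  have "norm (x + y) \<le> norm x + norm y" by (rule norm_triangle_ineq)
  then have "(norm (x + y))\<^sup>2 \<le> (norm x + norm y)\<^sup>2" by (intro power_mono) auto
  also have "\<dots> + 1 \<le> (smooth_norm x + norm y)\<^sup>2"
    using mult_right_mono[OF norm_le_smooth_norm[of x] norm_ge_zero[of y]]
    by (simp add: power2_sum smooth_norm_squared)
  finally have "1 + (norm (x + y))\<^sup>2 \<le> (smooth_norm x + norm y)\<^sup>2" by simp
  then show ?thesis
    unfolding smooth_norm_def[of "x + y"]
    by (intro real_le_lsqrt) (auto intro: add_nonneg_nonneg less_imp_le[OF smooth_norm_pos])
qed

lemma exp_le_quadratic:
  fixes u M :: real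
  assumes "\<bar>u\<bar> \<le> M"
  shows "exp u \<le> 1 + u + u\<^sup>2 * exp M"
proof -
  have "norm (exp u - (\<Sum>k\<le>1. u ^ k / fact k)) \<le> exp \<bar>u\<bar> * (\<bar>u\<bar> ^ Suc 1) / fact 1"
    using Taylor_exp_field[of u 1] by simp
  then have "exp u \<le> 1 + u + u\<^sup>2 * exp \<bar>u\<bar>"
    by (simp add: power2_eq_square abs_le_iff mult.commute)
  also have "\<dots> \<le> 1 + u + u\<^sup>2 * exp M" using assms by (intro add_left_mono mult_left_mono) auto
  finally show ?thesis .
qed

text \<open>
  The second-order bound for \<open>exp (lam * smooth_norm x)\<close>: its error term is relative to the value at
  \<open>x\<close>, with a constant that does not depend on \<open>x\<close>.
\<close>

lemma exp_smooth_norm_add_le_quadratic: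
  fixes x y :: "'a::real_inner"
  assumes lam: "0 \<le> lam" and y: "norm y \<le> 1"
  shows "exp (lam * smooth_norm (x + y)) \<le> exp (lam * smooth_norm x) *
     (1 + lam * ((x \<bullet> y) / smooth_norm x) + (lam / 2 + 4 * lam\<^sup>2 * exp (2 * lam)) * (norm y)\<^sup>2)"
proof -
  define u where "u = lam * ((x \<bullet> y) / smooth_norm x + (norm y)\<^sup>2 / 2)"
  have y2: "(norm y)\<^sup>2 \<le> norm y" using mult_left_le[OF y norm_ge_zero[of y]] by (simp add: power2_eq_square)
  have abs_u: "\<bar>u\<bar> \<le> 2 * lam * norm y"
  proof -
    have "\<bar>(x \<bullet> y) / smooth_norm x + (norm y)\<^sup>2 / 2\<bar> \<le> 2 * norm y"
      using abs_inner_div_smooth_norm_le[of x y] y2 zero_le_power2[of "norm y"] norm_ge_zero[of y] by linarith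
    then have "lam * \<bar>(x \<bullet> y) / smooth_norm x + (norm y)\<^sup>2 / 2\<bar> \<le> lam * (2 * norm y)"
      using lam by (rule mult_left_mono)
    then show ?thesis using lam by (simp add: u_def abs_mult)
  qed
  have "2 * lam * norm y \<le> 2 * lam" using lam y by (simp add: mult_left_le)
  then have "exp u \<le> 1 + u + u\<^sup>2 * exp (2 * lam)" using abs_u by (intro exp_le_quadratic) simp
  also have "u\<^sup>2 \<le> (2 * lam * norm y)\<^sup>2" using abs_u by (metis abs_ge_zero power2_abs power_mono)
  then have "1 + u + u\<^sup>2 * exp (2 * lam) \<le> 1 + u + (2 * lam * norm y)\<^sup>2 * exp (2 * lam)"
    by (intro add_left_mono mult_right_mono) auto
  finally have "exp u \<le> 1 + u + (2 * lam * norm y)\<^sup>2 * exp (2 * lam)" .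
  also have "\<dots> = 1 + lam * ((x \<bullet> y) / smooth_norm x) + (lam / 2 + 4 * lam\<^sup>2 * exp (2 * lam)) * (norm y)\<^sup>2"
    unfolding u_def by (simp add: algebra_simps power_mult_distrib)
  finally have *: "exp u \<le> \<dots>" .
  have "lam * smooth_norm (x + y) \<le> lam * smooth_norm x + u"
    using mult_left_mono[OF smooth_norm_add_le_quadratic[of x y] lam] by (simp add: u_def algebra_simps)
  then have "exp (lam * smooth_norm (x + y)) \<le> exp (lam * smooth_norm x) * exp u"
    by (simp flip: exp_add)
  also have "\<dots> \<le> exp (lam * smooth_norm x) * (1 + lam * ((x \<bullet> y) / smooth_norm x) + (lam / 2 + 4 * lam\<^sup>2 * exp (2 * lam)) * (norm y)\<^sup>2)"
    by (intro mult_left_mono *) auto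
  finally show ?thesis .
qed

lemma exp_smooth_norm_add_le:
  "0 \<le> lam \<Longrightarrow> exp (lam * smooth_norm (x + y)) \<le> exp (lam * smooth_norm x) * exp (lam * norm y)"
  using mult_left_mono[OF smooth_norm_add_le[of x y], of lam] by (simp add: distrib_left flip: exp_add)

lemma borel_measurable_smooth_norm [measurable]:
  "(smooth_norm :: 'a::euclidean_space \<Rightarrow> real) \<in> borel_measurable borel"
  unfolding smooth_norm_def[abs_def] by measurable

section \<open>Exponential moments from the Levy exponent\<close>

text \<open>
  The Levy--Khintchine exponent without Gaussian part of the jump measure \<open>\<nu>\<close> and the drift \<open>b\<close>, with
  the jumps in the open unit ball compensated.
\<close>

definition levy_exponent :: "'a::euclidean_space measure \<Rightarrow> 'a \<Rightarrow> 'a \<Rightarrow> complex" where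
  "levy_exponent \<nu> b k =
     (\<integral>y. iexp (k \<bullet> y) - 1 - \<i> * of_real ((k \<bullet> y) * indicator (ball 0 1) y) \<partial>\<nu>) + \<i> * of_real (b \<bullet> k)"

text \<open>
  A nonzero Levy measure that integrates \<open>exp (lam * |y|)\<close> away from the origin.  Mass at the origin
  is harmless, since the integrand of the exponent vanishes there.
\<close>

locale exp_levy_measure =
  fixes \<nu> :: "'a::euclidean_space measure" and lam :: real
  assumes sets_\<nu> [simp, measurable_cong]: "sets \<nu> = sets borel"
    and lam_pos: "0 < lam"
    and small: "integrable \<nu> (\<lambda>y. indicator (ball 0 1) y * (norm y)\<^sup>2)"
    and large: "integrable \<nu> (\<lambda>y. indicator (- ball 0 1) y * exp (lam * norm y))"
    and nontrivial: "emeasure \<nu> (- {0}) \<noteq> 0"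
begin

lemma norm_levy_integrand_le:
  "norm (iexp (k \<bullet> y) - 1 - \<i> * of_real ((k \<bullet> y) * indicator (ball 0 1) y)) \<le>
     (norm k)\<^sup>2 * (indicator (ball 0 1) y * (norm y)\<^sup>2) + 2 * (indicator (- ball 0 1) y * exp (lam * norm y))"
proof (cases "y \<in> ball 0 1")
  case True
  have "cmod (iexp (k \<bullet> y) - (\<Sum>j\<le>1. (\<i> * of_real (k \<bullet> y)) ^ j / fact j)) \<le> \<bar>k \<bullet> y\<bar> ^ Suc 1 / fact (Suc 1)"
    by (rule iexp_approx1)
  then have "norm (iexp (k \<bullet> y) - 1 - \<i> * of_real (k \<bullet> y)) \<le> \<bar>k \<bullet> y\<bar>\<^sup>2 / 2"
    by (simp add: algebra_simps numeral_2_eq_2)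
  also have "\<bar>k \<bullet> y\<bar>\<^sup>2 \<le> (norm k * norm y)\<^sup>2" by (intro power_mono Cauchy_Schwarz_ineq2) auto
  then have "\<bar>k \<bullet> y\<bar>\<^sup>2 / 2 \<le> (norm k)\<^sup>2 * (norm y)\<^sup>2"
    by (simp add: power_mult_distrib)
       (smt (verit) zero_le_power2 mult_nonneg_nonneg)
  finally show ?thesis using True by simp
next
  case False
  have "norm (iexp (k \<bullet> y) - 1) \<le> norm (iexp (k \<bullet> y)) + norm (1 :: complex)" by (rule norm_triangle_ineq4)
  also have "\<dots> = 2" by simp
  also have "\<dots> \<le> 2 * exp (lam * norm y)" using lam_pos by simp
  finally show ?thesis using False by simp
qed

lemma integrable_levy_integrand:
  "integrable \<nu> (\<lambda>y. iexp (k \<bullet> y) - 1 - \<i> * of_real ((k \<bullet> y) * indicator (ball 0 1) y))"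
proof (rule Bochner_Integration.integrable_bound)
  show "integrable \<nu> (\<lambda>y. (norm k)\<^sup>2 * (indicator (ball 0 1) y * (norm y)\<^sup>2) +
      2 * (indicator (- ball 0 1) y * exp (lam * norm y)))"
    using small large by auto
  show "(\<lambda>y. iexp (k \<bullet> y) - 1 - \<i> * of_real ((k \<bullet> y) * indicator (ball 0 1) y)) \<in> borel_measurable \<nu>"
    by measurable
  show "AE y in \<nu>. norm (iexp (k \<bullet> y) - 1 - \<i> * of_real ((k \<bullet> y) * indicator (ball 0 1) y)) \<le>
      norm ((norm k)\<^sup>2 * (indicator (ball 0 1) y * (norm y)\<^sup>2) +
        2 * (indicator (- ball 0 1) y * exp (lam * norm y)))"
    unfolding real_norm_def by (intro AE_I2 order_trans[OF norm_levy_integrand_le abs_ge_self])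
qed

text \<open>
  The jumps of size at least \<open>e\<close>; for \<open>e > 0\<close> this is a finite measure.
\<close>

definition trunc :: "real \<Rightarrow> 'a measure" where
  "trunc e = density \<nu> (\<lambda>y. ennreal (indicator {y. e \<le> norm y} y))"

lemma sets_trunc [simp, measurable_cong]: "sets (trunc e) = sets borel"
  by (simp add: trunc_def)

lemma space_trunc [simp]: "space (trunc e) = UNIV"
  using sets_eq_imp_space_eq[OF sets_trunc] by simp

lemma space_\<nu> [simp]: "space \<nu> = UNIV"
  using sets_eq_imp_space_eq[OF sets_\<nu>] by simp

lemma integrable_trunc:
  fixes f :: "'a \<Rightarrow> 'b::{banach, second_countable_topology}"
  assumes "integrable \<nu> f"
  shows "integrable (trunc e) f"
proof -
  have [measurable]: "f \<in> borel_measurable \<nu>" using assms by auto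
  show ?thesis
    unfolding trunc_def using integrable_mult_indicator[OF _ assms, of "{y. e \<le> norm y}"]
    by (subst integrable_density) auto
qed

lemma integral_trunc:
  fixes f :: "'a \<Rightarrow> 'b::{banach, second_countable_topology}"
  assumes "f \<in> borel_measurable borel"
  shows "(\<integral>y. f y \<partial>trunc e) = (\<integral>y. indicator {y. e \<le> norm y} y *\<^sub>R f y \<partial>\<nu>)"
  unfolding trunc_def using assms by (subst integral_density) auto

lemma integral_trunc_le:
  fixes f :: "'a \<Rightarrow> real"
  assumes "integrable \<nu> f" "\<And>y. 0 \<le> f y"
  shows "(\<integral>y. f y \<partial>trunc e) \<le> (\<integral>y. f y \<partial>\<nu>)"
proof -
  have [measurable]: "f \<in> borel_measurable borel" using assms(1) by auto
  show ?thesis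
    using integrable_mult_indicator[OF _ assms(1), of "{y. e \<le> norm y}"] assms
    by (subst integral_trunc) (auto intro!: integral_mono simp: indicator_def)
qed

lemma tendsto_integral_trunc:
  fixes f :: "'a \<Rightarrow> 'b::{banach, second_countable_topology}"
  assumes f: "integrable \<nu> f" "f 0 = 0" and e: "e \<longlonglongrightarrow> 0"
  shows "(\<lambda>j. \<integral>y. f y \<partial>trunc (e j)) \<longlonglongrightarrow> (\<integral>y. f y \<partial>\<nu>)"
proof -
  have [measurable]: "f \<in> borel_measurable borel" using f by auto
  have "(\<lambda>j. indicator {y. e j \<le> norm y} y *\<^sub>R f y) \<longlonglongrightarrow> f y" for y
  proof (cases "y = 0")
    case False
    then have "\<forall>\<^sub>F j in sequentially. e j < norm y" using e by (intro order_tendstoD) auto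
    then show ?thesis by (intro tendsto_eventually) (auto elim!: eventually_mono)
  qed (use f in simp)
  then show ?thesis
    using f by (subst integral_trunc, simp)
      (intro integral_dominated_convergence[where w = "\<lambda>y. norm (f y)"], auto simp: indicator_def)
qed

lemma finite_measure_trunc:
  assumes "0 < e"
  shows "finite_measure (trunc e)"
proof
  have "emeasure (trunc e) (space (trunc e)) = (\<integral>\<^sup>+y. ennreal (indicator {y. e \<le> norm y} y) \<partial>\<nu>)"
    by (simp add: trunc_def emeasure_density)
  also have "\<dots> \<le> (\<integral>\<^sup>+y. ennreal (inverse (e\<^sup>2) * (indicator (ball 0 1) y * (norm y)\<^sup>2) +
      indicator (- ball 0 1) y * exp (lam * norm y)) \<partial>\<nu>)"
  proof (intro nn_integral_mono ennreal_leI)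
    fix y :: 'a
    have "1 \<le> inverse (e\<^sup>2) * (norm y)\<^sup>2" if "e \<le> norm y"
      using that assms power_mono[of e "norm y" 2] by (simp add: field_simps)
    moreover have "1 \<le> exp (lam * norm y)" using lam_pos by simp
    ultimately show "indicator {y. e \<le> norm y} y \<le> inverse (e\<^sup>2) * (indicator (ball 0 1) y * (norm y)\<^sup>2) +
      indicator (- ball 0 1) y * exp (lam * norm y)"
      by (auto simp: indicator_def)
  qed
  also have "\<dots> < \<infinity>"
    using small large by (subst nn_integral_eq_integral) auto
  finally show "emeasure (trunc e) (space (trunc e)) \<noteq> \<infinity>" by simp
qed

abbreviation mass :: "real \<Rightarrow> real" where
  "mass e \<equiv> measure (trunc e) UNIV"

text \<open>
  The compensator of the truncated jumps.  It need not stay bounded as \<open>e\<close> tends to \<open>0\<close>.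
\<close>

definition drift :: "real \<Rightarrow> 'a" where
  "drift e = (\<integral>y. indicator (ball 0 1) y *\<^sub>R y \<partial>trunc e)"

lemma ex_mass_pos: "\<exists>e0>0. \<forall>e. 0 < e \<and> e \<le> e0 \<longrightarrow> 0 < mass e"
proof -
  have "\<exists>n. emeasure \<nu> {y. inverse (real (Suc n)) \<le> norm y} \<noteq> 0"
  proof (rule ccontr)
    assume "\<not> ?thesis"
    then have "{y. inverse (real (Suc n)) \<le> norm y} \<in> null_sets \<nu>" for n
      by (auto simp: null_sets_def)
    then have "(\<Union>n. {y. inverse (real (Suc n)) \<le> norm y}) \<in> null_sets \<nu>" by auto
    moreover have "(\<Union>n. {y::'a. inverse (real (Suc n)) \<le> norm y}) = - {0}"
    proof (intro set_eqI iffI)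
      fix y :: 'a assume "y \<in> - {0}"
      then obtain n where "inverse (real (Suc n)) < norm y" using reals_Archimedean[of "norm y"] by auto
      then show "y \<in> (\<Union>n. {y. inverse (real (Suc n)) \<le> norm y})" by (auto intro: less_imp_le)
    qed auto
    ultimately show False using nontrivial by auto
  qed
  then obtain n where n: "emeasure \<nu> {y. inverse (real (Suc n)) \<le> norm y} \<noteq> 0" ..
  have "0 < mass e" if e: "0 < e" "e \<le> inverse (real (Suc n))" for e
  proof -
    interpret finite_measure "trunc e" by (rule finite_measure_trunc[OF e(1)])
    have "emeasure \<nu> {y. inverse (real (Suc n)) \<le> norm y} \<le> emeasure \<nu> {y. e \<le> norm y}"
      using e by (intro emeasure_mono) auto
    also have "\<dots> = emeasure (trunc e) UNIV"
      by (simp add: trunc_def emeasure_density ennreal_indicator)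
    finally have "emeasure (trunc e) UNIV \<noteq> 0" using n by auto
    then show ?thesis by (simp add: emeasure_eq_measure zero_less_measure_iff)
  qed
  then show ?thesis by (intro exI[of _ "inverse (real (Suc n))"]) auto
qed

text \<open>
  One step of length \<open>d\<close> of the approximating random walk: with probability \<open>d * mass e\<close> there is a
  jump with the normalized law \<open>trunc e\<close>, and the shift \<open>d *\<^sub>R (b - drift e)\<close> consists of the drift and
  the compensator of the jumps in the unit ball.
\<close>

definition step :: "'a \<Rightarrow> real \<Rightarrow> real \<Rightarrow> 'a measure" where
  "step b e d = lazy_step (d * mass e) (scale_measure (ennreal (inverse (mass e))) (trunc e)) (d *\<^sub>R (b - drift e))"

text \<open>
  The exponential rate at which the mean of \<open>exp (lam * smooth_norm x)\<close> grows along the walk.  It does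
  not involve the truncation level.
\<close>

definition growth_rate :: "'a \<Rightarrow> real" where
  "growth_rate b = lam * norm b + (lam / 2 + 4 * lam\<^sup>2 * exp (2 * lam)) *
     (\<integral>y. indicator (ball 0 1) y * (norm y)\<^sup>2 \<partial>\<nu>) + (\<integral>y. indicator (- ball 0 1) y * exp (lam * norm y) \<partial>\<nu>)"

context
  fixes e d :: real
  assumes e: "0 < e" and mass: "0 < mass e" and d: "0 \<le> d" "d * mass e \<le> 1"
begin

interpretation T: finite_measure "trunc e" by (rule finite_measure_trunc[OF e])

lemma mass_neq_0: "mass e \<noteq> 0"
  using mass by simp

lemma prob_space_normalized_trunc:
  "prob_space (scale_measure (ennreal (inverse (mass e))) (trunc e))"
  using mass by (intro prob_spaceI)
    (simp add: space_scale_measure T.emeasure_eq_measure ennreal_mult[symmetric])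

lemma prob_space_step: "prob_space (step b e d)"
  unfolding step_def using d mass
  by (intro prob_space_lazy_step prob_space_normalized_trunc) auto

lemma integrable_drift_trunc: "integrable (trunc e) (\<lambda>y. indicator (ball 0 1) y *\<^sub>R y)"
  by (rule T.integrable_const_bound[where B = 1]) (auto simp: indicator_def)

lemma char_step:
  "(\<integral>x. iexp (k \<bullet> x) \<partial>step b e d) =
     iexp (d * (k \<bullet> (b - drift e))) * (1 + of_real d * (\<integral>y. iexp (k \<bullet> y) - 1 \<partial>trunc e))"
proof -
  have int: "integrable (trunc e) (\<lambda>y. iexp (k \<bullet> y))"
    by (rule T.integrable_const_bound[where B = 1]) auto
  have scale: "scale_measure (ennreal (inverse (mass e))) (trunc e) =
       density (trunc e) (\<lambda>_. ennreal (inverse (mass e)))"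
    by (intro measure_eqI) (auto simp: emeasure_density nn_integral_cmult)
  have "(\<integral>x. iexp (k \<bullet> x) \<partial>step b e d) =
      of_real (d * mass e) * (\<integral>y. iexp (k \<bullet> (d *\<^sub>R (b - drift e) + y)) \<partial>scale_measure (ennreal (inverse (mass e))) (trunc e))
       + of_real (1 - d * mass e) * iexp (k \<bullet> (d *\<^sub>R (b - drift e)))"
    unfolding step_def using d mass
    by (intro integral_lazy_step[where B = 1] prob_space_normalized_trunc) auto
  also have "(\<integral>y. iexp (k \<bullet> (d *\<^sub>R (b - drift e) + y)) \<partial>scale_measure (ennreal (inverse (mass e))) (trunc e)) =
      iexp (d * (k \<bullet> (b - drift e))) * (of_real (inverse (mass e)) * (\<integral>y. iexp (k \<bullet> y) \<partial>trunc e))"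
    unfolding scale using mass
    by (subst integral_density)
      (auto simp: inner_add_right exp_add distrib_left scaleR_conv_of_real)
  also have "(\<integral>y. iexp (k \<bullet> y) \<partial>trunc e) = (\<integral>y. iexp (k \<bullet> y) - 1 \<partial>trunc e) + of_real (mass e)"
    using int by (subst Bochner_Integration.integral_diff) (auto simp: scaleR_conv_of_real)
  finally have *: "(\<integral>x. iexp (k \<bullet> x) \<partial>step b e d) =
      of_real (d * mass e) * (iexp (d * (k \<bullet> (b - drift e))) * (of_real (inverse (mass e)) *
        ((\<integral>y. iexp (k \<bullet> y) - 1 \<partial>trunc e) + of_real (mass e)))) +
      of_real (1 - d * mass e) * iexp (k \<bullet> (d *\<^sub>R (b - drift e)))" .
  have "of_real (d * r) * (I * (of_real (inverse r) * (J + of_real r))) + of_real (1 - d * r) * I =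
      I * (1 + of_real d * J)" if "r \<noteq> 0" for r :: real and I J :: complex
    using that by (simp add: field_simps)
  from this[OF mass_neq_0] show ?thesis
    unfolding * by (simp only: inner_scaleR_right)
qed

text \<open>
  The estimate that survives the limit of small truncation levels.  Let \<open>x'\<close> be the position after the
  shift and \<open>v\<close> the gradient of \<open>smooth_norm\<close> at \<open>x'\<close>.  A jump contributes the first-order term
  \<open>v \<bullet> drift e\<close> and bounded terms.  By convexity the shift lowers \<open>smooth_norm\<close> by at least the
  same first-order term, up to \<open>v \<bullet> b\<close>, so that the unbounded compensator cancels.
\<close>

lemma nn_integral_step_le:
  "(\<integral>\<^sup>+u. ennreal (exp (lam * smooth_norm (x + u))) \<partial>step b e d) \<le>
     ennreal (exp (d * growth_rate b)) * ennreal (exp (lam * smooth_norm x))"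
proof -
  define s where "s = d *\<^sub>R (b - drift e)"
  define x' where "x' = x + s"
  define v where "v = x' /\<^sub>R smooth_norm x'"
  define G where "G = (\<lambda>x::'a. exp (lam * smooth_norm x))"
  have [measurable]: "G \<in> borel_measurable borel" unfolding G_def by measurable
  have G_pos: "0 < G x" for x by (simp add: G_def)
  define C1 where "C1 = lam / 2 + 4 * lam\<^sup>2 * exp (2 * lam)"
  have "0 \<le> C1" using lam_pos by (simp add: C1_def)
  define V where "V = (\<integral>y. indicator (ball 0 1) y * (norm y)\<^sup>2 \<partial>\<nu>)"
  define E where "E = (\<integral>y. indicator (- ball 0 1) y * exp (lam * norm y) \<partial>\<nu>)"
  define h where "h = (\<lambda>y::'a. 1 + lam * (v \<bullet> (indicator (ball 0 1) y *\<^sub>R y)) + C1 * (indicator (ball 0 1) y * (norm y)\<^sup>2) +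
     indicator (- ball 0 1) y * exp (lam * norm y))"
  have int: "integrable (trunc e) (\<lambda>y. indicator (ball 0 1) y * (norm y)\<^sup>2)"
     "integrable (trunc e) (\<lambda>y. indicator (- ball 0 1) y * exp (lam * norm y))"
    using small large by (auto intro: integrable_trunc)
  have int_h: "integrable (trunc e) h"
    unfolding h_def using int integrable_drift_trunc by (auto simp del: inner_scaleR_right)
  have "(\<integral>y. h y \<partial>trunc e) = mass e + lam * (v \<bullet> drift e) + C1 * (\<integral>y. indicator (ball 0 1) y * (norm y)\<^sup>2 \<partial>trunc e)
      + (\<integral>y. indicator (- ball 0 1) y * exp (lam * norm y) \<partial>trunc e)"
    unfolding h_def drift_def using int integrable_drift_trunc
    by (simp del: inner_scaleR_right)
  also have "\<dots> \<le> mass e + lam * (v \<bullet> drift e) + C1 * V + E"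
    unfolding V_def E_def using \<open>0 \<le> C1\<close> small large
    by (intro add_mono mult_left_mono integral_trunc_le order_refl) auto
  finally have int_h_le: "(\<integral>y. h y \<partial>trunc e) \<le> mass e + lam * (v \<bullet> drift e) + C1 * V + E" .
  have G_le: "G (x' + y) \<le> G x' * h y" for y
  proof (cases "y \<in> ball 0 1")
    case True
    then have "h y = 1 + lam * ((x' \<bullet> y) / smooth_norm x') + C1 * (norm y)\<^sup>2"
      by (simp add: h_def v_def divide_inverse mult.commute)
    then show ?thesis
      using exp_smooth_norm_add_le_quadratic[of lam y x'] lam_pos True unfolding G_def C1_def by simp
  next
    case False
    have "G (x' + y) \<le> G x' * exp (lam * norm y)"
      unfolding G_def using lam_pos by (intro exp_smooth_norm_add_le) simp
    also have "\<dots> \<le> G x' * h y"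
      using False G_pos[of x'] by (intro mult_left_mono) (auto simp: h_def)
    finally show ?thesis .
  qed
  have "(\<integral>\<^sup>+y. ennreal (G (x' + y)) \<partial>trunc e) \<le> (\<integral>\<^sup>+y. ennreal (G x' * h y) \<partial>trunc e)"
    by (intro nn_integral_mono ennreal_leI G_le)
  also have "\<dots> = ennreal (\<integral>y. G x' * h y \<partial>trunc e)"
    using int_h order_trans[OF less_imp_le[OF G_pos] G_le]
    by (intro nn_integral_eq_integral) auto
  also have "\<dots> \<le> ennreal (G x' * (mass e + lam * (v \<bullet> drift e) + C1 * V + E))"
    using int_h_le G_pos[of x'] by (intro ennreal_leI) auto
  finally have le1: "(\<integral>\<^sup>+y. ennreal (G (x' + y)) \<partial>trunc e) \<le>
      ennreal (G x' * (mass e + lam * (v \<bullet> drift e) + C1 * V + E))" .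
  have nonneg: "0 \<le> mass e + lam * (v \<bullet> drift e) + C1 * V + E"
  proof -
    have "0 \<le> h y" for y
      using order_trans[OF less_imp_le[OF G_pos] G_le[of y]] G_pos[of x'] by (simp add: zero_le_mult_iff)
    then have "0 \<le> (\<integral>y. h y \<partial>trunc e)" by simp
    with int_h_le show ?thesis by linarith
  qed
  have "(\<integral>\<^sup>+u. ennreal (G (x + u)) \<partial>step b e d) =
     ennreal (d * mass e) * (\<integral>\<^sup>+y. ennreal (G (x' + y)) \<partial>scale_measure (ennreal (inverse (mass e))) (trunc e))
       + ennreal (1 - d * mass e) * ennreal (G x')"
    unfolding step_def using d mass
    by (subst nn_integral_lazy_step) (auto simp: prob_space_normalized_trunc s_def x'_def add.assoc)
  also have "\<dots> = ennreal d * (\<integral>\<^sup>+y. ennreal (G (x' + y)) \<partial>trunc e) + ennreal (1 - d * mass e) * ennreal (G x')"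
  proof -
    have "ennreal (d * mass e) * ennreal (inverse (mass e)) = ennreal d"
      using d by (simp add: mass_neq_0 mult.assoc flip: ennreal_mult)
    then show ?thesis
      by (simp add: nn_integral_scale_measure flip: mult.assoc)
  qed
  also have "\<dots> \<le> ennreal d * ennreal (G x' * (mass e + lam * (v \<bullet> drift e) + C1 * V + E)) +
       ennreal (1 - d * mass e) * ennreal (G x')"
    by (intro add_right_mono mult_left_mono le1) auto
  also have "\<dots> = ennreal (d * (G x' * (mass e + lam * (v \<bullet> drift e) + C1 * V + E)) + (1 - d * mass e) * G x')"
    using d nonneg G_pos[of x'] by (simp add: ennreal_mult[symmetric] ennreal_plus[symmetric] del: ennreal_plus)
  also have "\<dots> = ennreal (G x' * (1 + d * (lam * (v \<bullet> drift e) + C1 * V + E)))"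
    by (simp add: algebra_simps)
  also have "\<dots> \<le> ennreal (exp (lam * smooth_norm x') * exp (d * (lam * (v \<bullet> drift e) + C1 * V + E)))"
    unfolding G_def by (intro ennreal_leI mult_left_mono exp_ge_add_one_self) auto
  also have "\<dots> \<le> ennreal (exp (d * growth_rate b) * exp (lam * smooth_norm x))"
  proof -
    \<comment> \<open>the tangent at the shifted point \<open>x'\<close>, evaluated at the point \<open>x\<close> before the shift\<close>
    have "smooth_norm x' + v \<bullet> (- s) \<le> smooth_norm x"
      using smooth_norm_tangent_le[of x' "- s"] by (simp add: v_def x'_def divide_inverse mult.commute)
    then have "smooth_norm x' + d * (v \<bullet> drift e) \<le> smooth_norm x + d * (v \<bullet> b)"
      by (simp add: s_def inner_diff_right algebra_simps)
    also have "\<dots> \<le> smooth_norm x + d * norm b"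
    proof -
      have "v \<bullet> b \<le> norm b"
        using abs_inner_div_smooth_norm_le[of x' b] by (simp add: v_def divide_inverse mult.commute)
      then show ?thesis using d by (intro add_left_mono mult_left_mono) auto
    qed
    finally have "lam * (smooth_norm x' + d * (v \<bullet> drift e)) \<le> lam * (smooth_norm x + d * norm b)"
      using lam_pos by (intro mult_left_mono) auto
    then have "lam * smooth_norm x' + d * (lam * (v \<bullet> drift e) + C1 * V + E) \<le> d * growth_rate b + lam * smooth_norm x"
      unfolding growth_rate_def C1_def[symmetric] V_def[symmetric] E_def[symmetric]
      by (simp add: algebra_simps)
    then show ?thesis by (intro ennreal_leI) (simp flip: exp_add)
  qed
  finally show ?thesis by (simp add: G_def ennreal_mult)
qed

end

end

context exp_levy_measure
begin

lemma sets_step [simp]: "sets (step b e d) = sets borel"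
  by (simp add: step_def)

text \<open>
  The distance between the characteristic function of the walk and the exponential of the truncated
  exponent is the usual error of \<open>(1 + z / n) ^ n\<close> against \<open>exp z\<close>.  As all factors have modulus at most
  \<open>1\<close>, it is controlled by \<open>|z|\<^sup>2 / n\<close> even where \<open>z\<close> is not bounded.
\<close>

lemma char_walk_approx:
  assumes e: "0 < e" and mass: "0 < mass e" and t: "0 \<le> t" and n: "0 < n" "t * mass e \<le> real n"
  shows "norm ((\<integral>x. iexp (k \<bullet> x) \<partial>walk_law (step b e (t / n)) n) -
      exp (of_real t * ((\<integral>y. iexp (k \<bullet> y) - 1 - \<i> * of_real ((k \<bullet> y) * indicator (ball 0 1) y) \<partial>trunc e)
        + \<i> * of_real (b \<bullet> k)))) \<le> 4 * exp 2 * (t * mass e)\<^sup>2 / n"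
proof -
  interpret T: finite_measure "trunc e" by (rule finite_measure_trunc[OF e])
  define d where "d = t / n"
  have d: "0 \<le> d" "d * mass e \<le> 1" using t n by (auto simp: d_def field_simps)
  interpret S: prob_space "step b e d" by (rule prob_space_step[OF e mass d])
  define A where "A = (\<integral>y. iexp (k \<bullet> y) - 1 \<partial>trunc e)"
  define R where "R = iexp (d * (k \<bullet> (b - drift e)))"
  have step: "(\<integral>x. iexp (k \<bullet> x) \<partial>step b e d) = R * (1 + of_real d * A)"
    unfolding A_def R_def by (rule char_step[OF e mass d])
  have int: "integrable (trunc e) (\<lambda>y. iexp (k \<bullet> y) - 1)"
    by (rule T.integrable_const_bound[where B = 2])
      (auto intro!: AE_I2 order_trans[OF norm_triangle_ineq4])
  have norm_A: "norm A \<le> 2 * mass e"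
  proof -
    have "norm A \<le> (\<integral>y. norm (iexp (k \<bullet> y) - 1) \<partial>trunc e)" unfolding A_def by (rule integral_norm_bound)
    also have "\<dots> \<le> (\<integral>y. 2 \<partial>trunc e)"
      using int by (intro integral_mono) (auto intro!: order_trans[OF norm_triangle_ineq4])
    finally show ?thesis by simp
  qed
  have Re_A: "Re A \<le> 0"
  proof -
    have "Re A = (\<integral>y. cos (k \<bullet> y) - 1 \<partial>trunc e)"
      unfolding A_def using int by (subst integral_Re[symmetric]) (auto simp: Re_exp)
    also have "\<dots> \<le> (\<integral>y. 0 \<partial>trunc e)"
      by (intro integral_mono_AE T.integrable_const_bound[where B = 2]) (auto simp: abs_le_iff intro!: AE_I2)
    finally show ?thesis by simp
  qed
  have norm_w: "norm (R * (1 + of_real d * A)) \<le> 1"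
  proof -
    have "norm (\<integral>x. iexp (k \<bullet> x) \<partial>step b e d) \<le> (\<integral>x. norm (iexp (k \<bullet> x)) \<partial>step b e d)"
      by (rule integral_norm_bound)
    then show ?thesis by (simp add: step S.prob_space del: norm_mult)
  qed
  have norm_v: "norm (R * exp (of_real d * A)) \<le> 1"
    using Re_A d by (simp add: norm_mult R_def mult_nonneg_nonpos)
  have diff: "norm (R * (1 + of_real d * A) - R * exp (of_real d * A)) \<le> exp 2 * (2 * d * mass e)\<^sup>2"
  proof -
    have dA: "norm (of_real d * A) \<le> 2 * d * mass e"
      using mult_left_mono[OF norm_A d(1)] d by (simp add: norm_mult mult.assoc mult.left_commute)
    have "norm (exp (of_real d * A) - (\<Sum>j\<le>1. (of_real d * A) ^ j / fact j)) \<le>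
       exp (norm (of_real d * A)) * (norm (of_real d * A) ^ Suc 1) / fact 1"
      by (rule Taylor_exp_field)
    also have "\<dots> = exp (norm (of_real d * A)) * (norm (of_real d * A))\<^sup>2"
      by (simp add: power2_eq_square)
    also have "\<dots> \<le> exp 2 * (2 * d * mass e)\<^sup>2"
      using dA d by (intro mult_mono power_mono) auto
    finally have "norm (exp (of_real d * A) - (1 + of_real d * A)) \<le> exp 2 * (2 * d * mass e)\<^sup>2"
      by simp
    then show ?thesis
      by (simp add: R_def norm_mult norm_minus_commute flip: right_diff_distrib)
  qed
  have drift: "of_real (k \<bullet> drift e) = (\<integral>y. of_real ((k \<bullet> y) * indicator (ball 0 1) y) \<partial>trunc e :: complex)"
    unfolding drift_def using integrable_drift_trunc[OF e mass d]
    by (simp add: mult.commute del: of_real_mult flip: integral_inner_right)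
  have int_drift: "integrable (trunc e) (\<lambda>y. complex_of_real ((k \<bullet> y) * indicator (ball 0 1) y))"
    using integrable_inner_right[OF integrable_drift_trunc[OF e mass d], of k]
    by (intro integrable_of_real) (simp add: mult.commute)
  have exponent: "(\<integral>y. iexp (k \<bullet> y) - 1 - \<i> * of_real ((k \<bullet> y) * indicator (ball 0 1) y) \<partial>trunc e)
        + \<i> * of_real (b \<bullet> k) = A + \<i> * of_real (k \<bullet> (b - drift e))"
  proof -
    have "(\<integral>y. iexp (k \<bullet> y) - 1 - \<i> * of_real ((k \<bullet> y) * indicator (ball 0 1) y) \<partial>trunc e) =
      A - \<i> * of_real (k \<bullet> drift e)"
      unfolding A_def drift using int int_drift
      by (subst Bochner_Integration.integral_diff) (auto simp del: of_real_mult)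
    then show ?thesis by (simp add: inner_diff_right inner_commute algebra_simps)
  qed
  have "(R * exp (of_real d * A)) ^ n = exp (of_real t * (A + \<i> * of_real (k \<bullet> (b - drift e))))"
  proof -
    have nd: "real n * d = t" using n by (simp add: d_def)
    have "(R * exp (of_real d * A)) ^ n = exp (of_nat n * (\<i> * of_real (d * (k \<bullet> (b - drift e))) + of_real d * A))"
      unfolding R_def by (simp add: exp_add[symmetric] exp_of_nat_mult)
    also have "of_nat n * (\<i> * of_real (d * (k \<bullet> (b - drift e))) + of_real d * A) =
       of_real (real n * d) * (A + \<i> * of_real (k \<bullet> (b - drift e)))"
      by (simp add: algebra_simps)
    finally show ?thesis unfolding nd .
  qed
  then have "norm ((\<integral>x. iexp (k \<bullet> x) \<partial>walk_law (step b e d) n) -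
      exp (of_real t * ((\<integral>y. iexp (k \<bullet> y) - 1 - \<i> * of_real ((k \<bullet> y) * indicator (ball 0 1) y) \<partial>trunc e)
        + \<i> * of_real (b \<bullet> k)))) = norm ((R * (1 + of_real d * A)) ^ n - (R * exp (of_real d * A)) ^ n)"
    unfolding exponent
    by (subst char_walk_law) (auto simp: S.prob_space_axioms step)
  also have "\<dots> \<le> n * norm (R * (1 + of_real d * A) - R * exp (of_real d * A))"
    by (rule norm_power_diff[OF norm_w norm_v])
  also have "\<dots> \<le> n * (exp 2 * (2 * d * mass e)\<^sup>2)"
    by (intro mult_left_mono diff) auto
  also have "\<dots> = 4 * exp 2 * (t * mass e)\<^sup>2 / n"
    using n by (simp add: d_def power2_eq_square field_simps)
  finally show ?thesis unfolding d_def .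
qed

text \<open>
  A probability measure with the characteristic function of the Levy process at time \<open>t\<close> has a moment
  for the weight \<open>exp (lam * |x|)\<close>, bounded locally uniformly in \<open>t\<close>.
\<close>

theorem exp_moment:
  obtains K where "\<And>\<mu> t. prob_space \<mu> \<Longrightarrow> sets \<mu> = sets borel \<Longrightarrow> 0 \<le> t \<Longrightarrow>
    (\<And>k. (\<integral>x. iexp (k \<bullet> x) \<partial>\<mu>) = exp (of_real t * levy_exponent \<nu> b k)) \<Longrightarrow>
    (\<integral>\<^sup>+x. ennreal (exp (lam * norm x)) \<partial>\<mu>) \<le> ennreal (K * exp (growth_rate b * t))"
proof -
  obtain e0 where e0: "0 < e0" "\<And>e. 0 < e \<Longrightarrow> e \<le> e0 \<Longrightarrow> 0 < mass e"
    using ex_mass_pos by blast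
  define e where "e j = e0 / real (Suc j)" for j
  have e: "0 < e j" "e j \<le> e0" for j
    using e0 by (auto simp: e_def divide_le_eq mult_le_cancel_left1)
  have mass: "0 < mass (e j)" for j using e e0 by blast
  have e_lim: "e \<longlonglongrightarrow> 0"
    unfolding e_def by (rule LIMSEQ_Suc[OF lim_const_over_n])
  obtain K0 where K0: "0 \<le> K0" "\<And>(\<mu> :: 'a measure) \<mu>s (g :: 'a \<Rightarrow> real) L.
      prob_space \<mu> \<Longrightarrow> sets \<mu> = sets borel \<Longrightarrow>
      (\<And>j::nat. prob_space (\<mu>s j)) \<Longrightarrow> (\<And>j. sets (\<mu>s j) = sets borel) \<Longrightarrow>
      (\<And>k. (\<lambda>j. \<integral>x. iexp (k \<bullet> x) \<partial>\<mu>s j) \<longlonglongrightarrow> (\<integral>x. iexp (k \<bullet> x) \<partial>\<mu>)) \<Longrightarrow>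
      g \<in> borel_measurable borel \<Longrightarrow> (\<And>x. 0 \<le> g x) \<Longrightarrow>
      (\<And>x w. g (x + w) \<le> g x * exp (lam * norm w)) \<Longrightarrow>
      (\<And>j. (\<integral>\<^sup>+x. g x \<partial>\<mu>s j) \<le> L) \<Longrightarrow> (\<integral>\<^sup>+x. g x \<partial>\<mu>) \<le> ennreal K0 * L"
    using nn_integral_le_of_tendsto_char[of lam, where 'a = 'a] lam_pos by (metis less_imp_le)
  have "(\<integral>\<^sup>+x. ennreal (exp (lam * norm x)) \<partial>\<mu>) \<le> ennreal (K0 * exp lam * exp (growth_rate b * t))"
    if \<mu>: "prob_space \<mu>" and sets_\<mu> [simp, measurable_cong]: "sets \<mu> = sets borel" and t: "0 \<le> t"
      and char: "\<And>k. (\<integral>x. iexp (k \<bullet> x) \<partial>\<mu>) = exp (of_real t * levy_exponent \<nu> b k)"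
    for \<mu> t
  proof -
    \<comment> \<open>so many steps that the error \<open>(t * mass (e j))\<^sup>2 / n j\<close> tends to \<open>0\<close>\<close>
    define n where "n j = nat \<lceil>real (Suc j) * (1 + (t * mass (e j))\<^sup>2)\<rceil>" for j
    have n_ge: "real (Suc j) * (1 + (t * mass (e j))\<^sup>2) \<le> n j" for j
      unfolding n_def by (rule real_nat_ceiling_ge)
    have n: "0 < n j" "t * mass (e j) \<le> n j" "(t * mass (e j))\<^sup>2 / n j \<le> 1 / real (Suc j)" for j
    proof -
      have "1 + (t * mass (e j))\<^sup>2 \<le> real (Suc j) * (1 + (t * mass (e j))\<^sup>2)"
        using mult_right_mono[of 1 "real (Suc j)" "1 + (t * mass (e j))\<^sup>2"] by simp
      then have *: "1 + (t * mass (e j))\<^sup>2 \<le> n j" using n_ge[of j] by linarith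
      then show "0 < n j" by (metis add_pos_nonneg less_le_trans of_nat_0_less_iff zero_le_power2 zero_less_one)
      have "t * mass (e j) \<le> 1 + (t * mass (e j))\<^sup>2"
      proof -
        have "2 * (t * mass (e j)) \<le> 1 + (t * mass (e j))\<^sup>2"
          using zero_le_power2[of "t * mass (e j) - 1"] unfolding power2_diff by simp
        moreover have "0 \<le> (t * mass (e j))\<^sup>2" by simp
        ultimately show ?thesis by linarith
      qed
      then show "t * mass (e j) \<le> n j" using * by linarith
      have "real (Suc j) * (t * mass (e j))\<^sup>2 \<le> n j"
        using n_ge[of j] by (simp add: distrib_left)
      then show "(t * mass (e j))\<^sup>2 / n j \<le> 1 / real (Suc j)"
        using \<open>0 < n j\<close> by (simp add: field_simps)
    qed
    define d where "d j = t / n j" for j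
    have d: "0 \<le> d j" "d j * mass (e j) \<le> 1" for j
      using n[of j] t by (auto simp: d_def field_simps)
    define \<mu>s where "\<mu>s j = walk_law (step b (e j) (d j)) (n j)" for j
    have sets_step: "sets (step b (e j) (d j)) = sets borel" for j by simp
    have prob_step: "prob_space (step b (e j) (d j))" for j by (rule prob_space_step[OF e(1) mass d])
    have \<mu>s: "prob_space (\<mu>s j)" "sets (\<mu>s j) = sets borel" for j
      unfolding \<mu>s_def by (auto intro: prob_space_walk_law prob_step sets_step)
    have conv: "(\<lambda>j. \<integral>x. iexp (k \<bullet> x) \<partial>\<mu>s j) \<longlonglongrightarrow> (\<integral>x. iexp (k \<bullet> x) \<partial>\<mu>)" for k
    proof -
      define \<psi> where "\<psi> j = (\<integral>y. iexp (k \<bullet> y) - 1 - \<i> * of_real ((k \<bullet> y) * indicator (ball 0 1) y) \<partial>trunc (e j))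
        + \<i> * of_real (b \<bullet> k)" for j
      have "\<psi> \<longlonglongrightarrow> levy_exponent \<nu> b k"
        unfolding \<psi>_def levy_exponent_def
        by (intro tendsto_add tendsto_const tendsto_integral_trunc integrable_levy_integrand e_lim) simp
      then have 1: "(\<lambda>j. exp (of_real t * \<psi> j)) \<longlonglongrightarrow> exp (of_real t * levy_exponent \<nu> b k)"
        by (intro tendsto_intros)
      have "(\<lambda>j. (\<integral>x. iexp (k \<bullet> x) \<partial>\<mu>s j) - exp (of_real t * \<psi> j)) \<longlonglongrightarrow> 0"
      proof (rule Lim_null_comparison[OF always_eventually])
        show "\<forall>j. norm ((\<integral>x. iexp (k \<bullet> x) \<partial>\<mu>s j) - exp (of_real t * \<psi> j)) \<le> 4 * exp 2 / real (Suc j)"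
        proof
          fix j
          have "norm ((\<integral>x. iexp (k \<bullet> x) \<partial>\<mu>s j) - exp (of_real t * \<psi> j)) \<le> 4 * exp 2 * (t * mass (e j))\<^sup>2 / n j"
            unfolding \<mu>s_def \<psi>_def d_def by (rule char_walk_approx[OF e(1) mass t n(1,2)])
          also have "\<dots> = 4 * exp 2 * ((t * mass (e j))\<^sup>2 / n j)" by simp
          also have "\<dots> \<le> 4 * exp 2 * (1 / real (Suc j))"
            by (intro mult_left_mono n(3)) auto
          finally show "norm ((\<integral>x. iexp (k \<bullet> x) \<partial>\<mu>s j) - exp (of_real t * \<psi> j)) \<le> 4 * exp 2 / real (Suc j)"
            by simp
        qed
        show "(\<lambda>j. 4 * exp 2 / real (Suc j)) \<longlonglongrightarrow> 0"
          by (rule LIMSEQ_Suc[OF lim_const_over_n])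
      qed
      from tendsto_add[OF this 1] show ?thesis by (simp add: char)
    qed
    have moment: "(\<integral>\<^sup>+x. ennreal (exp (lam * smooth_norm x)) \<partial>\<mu>s j) \<le> ennreal (exp (growth_rate b * t) * exp lam)" for j
    proof -
      have "(\<integral>\<^sup>+x. ennreal (exp (lam * smooth_norm x)) \<partial>\<mu>s j) \<le>
          ennreal (exp (d j * growth_rate b)) ^ n j * ennreal (exp (lam * smooth_norm (0::'a)))"
        unfolding \<mu>s_def
        by (rule nn_integral_walk_law_le[OF prob_step sets_step _ nn_integral_step_le[OF e(1) mass d]]) measurable
      also have "\<dots> = ennreal (exp (real (n j) * (d j * growth_rate b)) * exp lam)"
        by (simp add: ennreal_power exp_of_nat_mult smooth_norm_def ennreal_mult)
      also have "real (n j) * (d j * growth_rate b) = growth_rate b * t"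
        using n(1)[of j] by (simp add: d_def)
      finally show ?thesis .
    qed
    have "(\<integral>\<^sup>+x. ennreal (exp (lam * norm x)) \<partial>\<mu>) \<le> (\<integral>\<^sup>+x. ennreal (exp (lam * smooth_norm x)) \<partial>\<mu>)"
      using lam_pos by (intro nn_integral_mono ennreal_leI) (auto intro: norm_le_smooth_norm)
    also have "\<dots> \<le> ennreal K0 * ennreal (exp (growth_rate b * t) * exp lam)"
      by (rule K0(2)[OF \<mu> sets_\<mu> \<mu>s conv _ _ _ moment])
        (use lam_pos in \<open>auto intro: exp_smooth_norm_add_le\<close>)
    finally show ?thesis using K0(1) by (simp add: ac_simps flip: ennreal_mult)
  qed
  with that show thesis by blast
qed

end

section \<open>Large increments have positive probability\<close>

context exp_levy_measure
begin

lemma Re_levy_exponent: "Re (levy_exponent \<nu> b k) = - (\<integral>y. 1 - cos (k \<bullet> y) \<partial>\<nu>)"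
  and integrable_1_minus_cos: "integrable \<nu> (\<lambda>y. 1 - cos (k \<bullet> y))"
proof -
  note int = integrable_levy_integrand[of k]
  have eq: "Re (iexp (k \<bullet> y) - 1 - \<i> * of_real ((k \<bullet> y) * indicator (ball 0 1) y)) = - (1 - cos (k \<bullet> y))" for y
    by (simp add: Re_exp)
  show "integrable \<nu> (\<lambda>y. 1 - cos (k \<bullet> y))"
    using Bochner_Integration.integrable_minus[OF integrable_Re[OF int]] unfolding eq by simp
  show "Re (levy_exponent \<nu> b k) = - (\<integral>y. 1 - cos (k \<bullet> y) \<partial>\<nu>)"
    using integral_Re[OF int] unfolding eq levy_exponent_def by (simp flip: integral_minus)
qed

text \<open>
  Some coordinate of the jumps is nonzero and bounded with positive mass.  A small multiple of that
  coordinate has modulus in \<open>(0, 1]\<close>, where the cosine is less than \<open>1\<close>.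
\<close>

lemma ex_Re_levy_exponent_neg:
  assumes "0 < r"
  obtains k where "norm k \<le> r" "Re (levy_exponent \<nu> b k) < 0"
proof -
  have "\<exists>i\<in>Basis. \<exists>n::nat. emeasure \<nu> {y. 0 < \<bar>i \<bullet> y\<bar> \<and> \<bar>i \<bullet> y\<bar> \<le> n} \<noteq> 0"
  proof (rule ccontr)
    assume "\<not> ?thesis"
    then have "{y. 0 < \<bar>i \<bullet> y\<bar> \<and> \<bar>i \<bullet> y\<bar> \<le> real n} \<in> null_sets \<nu>" if "i \<in> Basis" for i n
      using that by (auto simp: null_sets_def)
    then have "(\<Union>i\<in>Basis. \<Union>n::nat. {y. 0 < \<bar>i \<bullet> y\<bar> \<and> \<bar>i \<bullet> y\<bar> \<le> n}) \<in> null_sets \<nu>"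
      by (intro null_sets_UN' null_sets_UN) (auto simp: countable_finite)
    moreover have "(\<Union>i\<in>Basis. \<Union>n::nat. {y::'a. 0 < \<bar>i \<bullet> y\<bar> \<and> \<bar>i \<bullet> y\<bar> \<le> n}) = - {0}"
    proof (intro set_eqI iffI)
      fix y :: 'a assume "y \<in> - {0}"
      then obtain i where "i \<in> Basis" "y \<bullet> i \<noteq> 0" by (auto simp: euclidean_eq_iff[of y])
      moreover obtain n :: nat where "\<bar>i \<bullet> y\<bar> \<le> n" using real_arch_simple by blast
      ultimately show "y \<in> (\<Union>i\<in>Basis. \<Union>n::nat. {y. 0 < \<bar>i \<bullet> y\<bar> \<and> \<bar>i \<bullet> y\<bar> \<le> n})"
        by (auto simp: inner_commute)
    qed auto
    ultimately show False using nontrivial by auto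
  qed
  then obtain i n where i: "i \<in> Basis" and n: "emeasure \<nu> {y. 0 < \<bar>i \<bullet> y\<bar> \<and> \<bar>i \<bullet> y\<bar> \<le> real n} \<noteq> 0"
    by blast
  define c where "c = min r (1 / (real n + 1))"
  have c: "0 < c" "c \<le> r" "c * real n \<le> 1"
  proof -
    show "0 < c" "c \<le> r" using assms by (auto simp: c_def)
    have "c * real n \<le> 1 / (real n + 1) * real n" by (intro mult_right_mono) (auto simp: c_def)
    also have "\<dots> \<le> 1" by (simp add: field_simps)
    finally show "c * real n \<le> 1" .
  qed
  show thesis
  proof
    show "norm (c *\<^sub>R i) \<le> r" using c i by simp
    have "(\<integral>y. 1 - cos (c *\<^sub>R i \<bullet> y) \<partial>\<nu>) \<noteq> 0"
    proof
      assume "(\<integral>y. 1 - cos (c *\<^sub>R i \<bullet> y) \<partial>\<nu>) = 0"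
      then have "AE y in \<nu>. 1 - cos (c *\<^sub>R i \<bullet> y) = 0"
        by (subst (asm) integral_nonneg_eq_0_iff_AE[OF integrable_1_minus_cos]) auto
      moreover have "cos (c *\<^sub>R i \<bullet> y) \<noteq> 1" if y: "0 < \<bar>i \<bullet> y\<bar>" "\<bar>i \<bullet> y\<bar> \<le> real n" for y
      proof -
        have "\<bar>c *\<^sub>R i \<bullet> y\<bar> = c * \<bar>i \<bullet> y\<bar>" using c by (simp add: abs_mult)
        moreover have "c * \<bar>i \<bullet> y\<bar> \<le> c * real n" using y c by (intro mult_left_mono) auto
        moreover have "0 < c * \<bar>i \<bullet> y\<bar>" using y c by simp
        ultimately have "0 < \<bar>c *\<^sub>R i \<bullet> y\<bar>" "\<bar>c *\<^sub>R i \<bullet> y\<bar> \<le> 1" using c by linarith+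
        then have "cos \<bar>c *\<^sub>R i \<bullet> y\<bar> < cos 0"
          using pi_gt3 by (intro cos_monotone_0_pi) auto
        then show ?thesis by simp
      qed
      ultimately have "AE y in \<nu>. y \<notin> {y. 0 < \<bar>i \<bullet> y\<bar> \<and> \<bar>i \<bullet> y\<bar> \<le> real n}"
        by (auto elim!: eventually_mono)
      then have "emeasure \<nu> {y. 0 < \<bar>i \<bullet> y\<bar> \<and> \<bar>i \<bullet> y\<bar> \<le> real n} = 0"
        by (subst (asm) AE_iff_measurable[OF _ refl]) auto
      with n show False by simp
    qed
    moreover have "0 \<le> (\<integral>y. 1 - cos (c *\<^sub>R i \<bullet> y) \<partial>\<nu>)"
      by (intro integral_nonneg_AE) auto
    ultimately have "0 < (\<integral>y. 1 - cos (c *\<^sub>R i \<bullet> y) \<partial>\<nu>)" by linarith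
    then show "Re (levy_exponent \<nu> b (c *\<^sub>R i)) < 0"
      by (simp add: Re_levy_exponent)
  qed
qed

text \<open>
  For a frequency of modulus at most \<open>1 / (r + 1)\<close>, a law concentrated on \<open>cball 0 r\<close> has a characteristic
  function of modulus at least \<open>cos 1 \<ge> 1 / 2\<close>.  The modulus for the process at time \<open>T\<close> is
  \<open>exp (T * Re \<psi>)\<close>, which falls below \<open>1 / 2\<close>.
\<close>

lemma ex_time_not_confined:
  assumes "0 \<le> r"
  obtains T where "0 < T" "\<And>\<mu>. prob_space \<mu> \<Longrightarrow> sets \<mu> = sets borel \<Longrightarrow>
    (\<And>k. (\<integral>x. iexp (k \<bullet> x) \<partial>\<mu>) = exp (of_real T * levy_exponent \<nu> b k)) \<Longrightarrow> measure \<mu> (cball 0 r) < 1"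
proof -
  obtain k where k: "norm k \<le> 1 / (r + 1)" and neg: "Re (levy_exponent \<nu> b k) < 0"
    using ex_Re_levy_exponent_neg[of "1 / (r + 1)" b] assms by auto
  define T where "T = 1 / - Re (levy_exponent \<nu> b k)"
  have T: "0 < T" "T * Re (levy_exponent \<nu> b k) = - 1"
    using neg by (auto simp: T_def)
  have "measure \<mu> (cball 0 r) < 1"
    if \<mu>: "prob_space \<mu>" and sets_\<mu> [simp, measurable_cong]: "sets \<mu> = sets borel"
      and char: "(\<integral>x. iexp (k \<bullet> x) \<partial>\<mu>) = exp (of_real T * levy_exponent \<nu> b k)" for \<mu> :: "'a measure"
  proof (rule ccontr)
    interpret \<mu>: prob_space \<mu> by (rule \<mu>)
    assume "\<not> measure \<mu> (cball 0 r) < 1"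
    then have "measure \<mu> (cball 0 r) = 1" using \<mu>.prob_le_1[of "cball 0 r"] by linarith
    then have ae: "AE x in \<mu>. x \<in> cball 0 r" by (subst \<mu>.AE_in_set_eq_1) auto
    have "1 / 2 \<le> cos (1::real)"
      using cos_monotone_0_pi_le[of 1 "pi / 3"] pi_gt3 by (simp add: cos_60)
    also have "cos 1 = (\<integral>x. cos 1 \<partial>\<mu>)" by (simp add: \<mu>.prob_space)
    also have "\<dots> \<le> (\<integral>x. cos (k \<bullet> x) \<partial>\<mu>)"
    proof (rule integral_mono_AE)
      show "AE x in \<mu>. cos 1 \<le> cos (k \<bullet> x)"
        using ae
      proof eventually_elim
        fix x :: 'a assume x: "x \<in> cball 0 r"
        have "\<bar>k \<bullet> x\<bar> \<le> norm k * norm x" by (rule Cauchy_Schwarz_ineq2)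
        also have "\<dots> \<le> 1 / (r + 1) * r" using k x assms by (intro mult_mono) auto
        also have "\<dots> \<le> 1" using assms by (simp add: field_simps)
        finally have "cos 1 \<le> cos \<bar>k \<bullet> x\<bar>" using pi_gt3 by (intro cos_monotone_0_pi_le) auto
        then show "cos 1 \<le> cos (k \<bullet> x)" by simp
      qed
    qed (auto intro!: \<mu>.integrable_const_bound[where B = 1])
    also have "\<dots> = Re (\<integral>x. iexp (k \<bullet> x) \<partial>\<mu>)"
      by (subst integral_Re[symmetric]) (auto intro!: \<mu>.integrable_const_bound[where B = 1] simp: Re_exp)
    also have "\<dots> \<le> norm (\<integral>x. iexp (k \<bullet> x) \<partial>\<mu>)" by (rule complex_Re_le_cmod)
    also have "\<dots> = exp (- 1)" unfolding char by (simp add: T)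
    finally have "exp 1 \<le> (2::real)" by (simp add: exp_minus field_simps)
    moreover have "(2::real) < exp 1" 
      using exp_lower_Taylor_quadratic[of "1::real"] by simp
    ultimately show False by simp
  qed
  with T(1) that show thesis by blast
qed

end

section \<open>The jump measure of the tempered stable process\<close>

text \<open>
  The extension of \<open>m\<close> to a function that is constant on the open rays from the origin, with value \<open>0\<close>
  at the origin.
\<close>

definition radial_extension :: "('a::euclidean_space \<Rightarrow> real) \<Rightarrow> 'a \<Rightarrow> real" where
  "radial_extension m y = indicator (sphere 0 1) (sgn y) * m (sgn y)"

lemma borel_measurable_sgn_euclidean [measurable]: "(sgn :: 'a::euclidean_space \<Rightarrow> 'a) \<in> borel_measurable borel"
  unfolding sgn_div_norm[abs_def] by measurable

lemma tempered_stable_density_eq: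
  "tempered_stable_density m \<alpha> lam y =
     radial_extension m y / (exp (lam * norm y) * norm y powr (real DIM('a) + \<alpha>))"
  for y :: "'a::euclidean_space"
  by (cases "y = 0") (simp_all add: tempered_stable_density_def radial_extension_def norm_sgn)

lemma radial_extension_scaleR: "0 < s \<Longrightarrow> radial_extension m (s *\<^sub>R y) = radial_extension m y"
  by (simp add: radial_extension_def sgn_scaleR)

text \<open>
  A spreading density on the unit sphere.
\<close>

locale sphere_density =
  fixes m :: "'a::euclidean_space \<Rightarrow> real"
  assumes density: "sphere_prob_density m"
begin

lemma borel_measurable_radial_extension [measurable]: "radial_extension m \<in> borel_measurable borel"
proof -
  have "m \<in> borel_measurable (restrict_space borel (sphere 0 1))"
    using density by (simp add: sphere_prob_density_def)
  then have [measurable]: "(\<lambda>y. indicator (sphere 0 1) y *\<^sub>R m y) \<in> borel_measurable borel"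
    by (subst (asm) borel_measurable_restrict_space_iff) auto
  have "(\<lambda>y. indicator (sphere 0 1) (sgn y) *\<^sub>R m (sgn y)) \<in> borel_measurable borel"
    by (rule measurable_compose[where f = sgn]) measurable
  then show ?thesis unfolding radial_extension_def[abs_def] by simp
qed

lemma radial_extension_nonneg: "0 \<le> radial_extension m y"
  using density by (simp add: radial_extension_def sphere_prob_density_def indicator_def)

text \<open>
  The normalization of \<open>m\<close> in terms of Lebesgue measure on the unit ball.
\<close>

lemma nn_integral_radial_extension_cball:
  "of_nat DIM('a) * (\<integral>\<^sup>+y. ennreal (radial_extension m y) * indicator (cball 0 1) y \<partial>lborel) = 1"
proof -
  have m: "m \<in> borel_measurable (restrict_space borel (sphere 0 1))" "\<And>\<phi>. \<phi> \<in> sphere 0 1 \<Longrightarrow> 0 \<le> m \<phi>"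
    "has_bochner_integral sphere_measure m 1"
    using density by (auto simp: sphere_prob_density_def)
  have sgn: "sgn \<in> measurable (restrict_space lborel (cball 0 1 - {0})) (restrict_space borel (sphere (0::'a) 1))"
    by (rule measurable_restrict_space2)
      (auto simp: space_restrict_space norm_sgn intro!: measurable_restrict_space1)
  have space: "space (sphere_measure :: 'a measure) = sphere 0 1"
    by (simp add: sphere_measure_def space_scale_measure space_restrict_space)
  have "1 = (\<integral>\<^sup>+\<phi>. ennreal (m \<phi>) \<partial>sphere_measure)"
    using m by (subst nn_integral_eq_integral) (auto simp: space has_bochner_integral_iff intro!: AE_I2)
  also have "\<dots> = of_nat DIM('a) * (\<integral>\<^sup>+\<phi>. ennreal (m \<phi>)
      \<partial>distr (restrict_space lborel (cball 0 1 - {0})) (restrict_space borel (sphere 0 1)) sgn)"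
    unfolding sphere_measure_def using m(1) by (subst nn_integral_scale_measure) auto
  also have "(\<integral>\<^sup>+\<phi>. ennreal (m \<phi>)
      \<partial>distr (restrict_space lborel (cball 0 1 - {0})) (restrict_space borel (sphere 0 1)) sgn) =
      (\<integral>\<^sup>+y. ennreal (m (sgn y)) \<partial>restrict_space lborel (cball 0 1 - {0}))"
    using m(1) by (intro nn_integral_distr sgn) measurable
  also have "\<dots> = (\<integral>\<^sup>+y. ennreal (m (sgn y)) * indicator (cball 0 1 - {0}) y \<partial>lborel)"
    by (subst nn_integral_restrict_space) auto
  also have "\<dots> = (\<integral>\<^sup>+y. ennreal (radial_extension m y) * indicator (cball 0 1) y \<partial>lborel)"
    by (intro nn_integral_cong) (auto simp: radial_extension_def norm_sgn indicator_def)
  finally show ?thesis ..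
qed

text \<open>
  The integral of \<open>m (y / |y|) |y| powr a\<close> over the shell \<open>s / 2 < |y| \<le> s\<close> is proportional to
  \<open>s powr (d + a)\<close> by scaling.  Hence the integrals over the shells for \<open>s = \<rho> ^ n\<close> form a geometric
  series.  The ratio \<open>\<rho> = 1 / 2\<close> serves near the origin and \<open>\<rho> = 2\<close> near infinity.
\<close>

lemma nn_integral_radial_shells_finite:
  assumes \<rho>: "0 < \<rho>" "\<rho> powr (real DIM('a) + a) < 1"
  shows "(\<integral>\<^sup>+y. ennreal (radial_extension m y * norm y powr a) *
           indicator (\<Union>n. {y. \<rho> ^ n / 2 < norm y \<and> norm y \<le> \<rho> ^ n}) y \<partial>lborel) < \<infinity>"
proof -
  define S where "S s = {y::'a. s / 2 < norm y \<and> norm y \<le> s}" for s :: real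
  have [measurable]: "S s \<in> sets borel" for s unfolding S_def by measurable
  define F where "F y = ennreal (radial_extension m y * norm y powr a)" for y
  have [measurable]: "F \<in> borel_measurable borel" unfolding F_def by measurable
  define I where "I s = (\<integral>\<^sup>+y. F y * indicator (S s) y \<partial>lborel)" for s
  have scaling: "I s = ennreal (s powr (real DIM('a) + a)) * I 1" if s: "0 < s" for s
  proof -
    have "I s = (\<integral>\<^sup>+y. F y * indicator (S s) y \<partial>density (distr lborel borel (\<lambda>y. 0 + s *\<^sub>R y)) (\<lambda>_. ennreal (\<bar>s\<bar> ^ DIM('a))))"
      unfolding I_def using s by (subst lborel_affine[of s 0]) auto
    also have "\<dots> = (\<integral>\<^sup>+y. ennreal (s ^ DIM('a)) * (F (s *\<^sub>R y) * indicator (S s) (s *\<^sub>R y)) \<partial>lborel)"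
      using s by (simp add: nn_integral_density nn_integral_distr)
    also have "\<dots> = (\<integral>\<^sup>+y. ennreal (s powr (real DIM('a) + a)) * (F y * indicator (S 1) y) \<partial>lborel)"
    proof (intro nn_integral_cong)
      fix y :: 'a
      have "indicator (S s) (s *\<^sub>R y) = (indicator (S 1) y :: ennreal)"
        using s by (auto simp: S_def indicator_def field_simps)
      moreover have "ennreal (s ^ DIM('a)) * F (s *\<^sub>R y) = ennreal (s powr (real DIM('a) + a)) * F y"
        using s by (simp add: F_def radial_extension_scaleR powr_mult powr_add powr_realpow radial_extension_nonneg
            mult.assoc mult.left_commute flip: ennreal_mult)
      ultimately show "ennreal (s ^ DIM('a)) * (F (s *\<^sub>R y) * indicator (S s) (s *\<^sub>R y)) =
        ennreal (s powr (real DIM('a) + a)) * (F y * indicator (S 1) y)"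
        by (simp flip: mult.assoc)
    qed
    also have "\<dots> = ennreal (s powr (real DIM('a) + a)) * I 1"
      unfolding I_def by (rule nn_integral_cmult) measurable
    finally show ?thesis .
  qed
  have I_1: "I 1 < \<infinity>"
  proof -
    have "I 1 \<le> (\<integral>\<^sup>+y. ennreal (1 + (1 / 2) powr a) * (ennreal (radial_extension m y) * indicator (cball 0 1) y) \<partial>lborel)"
      unfolding I_def
    proof (intro nn_integral_mono)
      fix y :: 'a
      have "radial_extension m y * norm y powr a \<le> (1 + (1 / 2) powr a) * radial_extension m y" if "y \<in> S 1"
      proof -
        have "norm y powr a \<le> 1 + (1 / 2) powr a"
        proof (cases "0 \<le> a")
          case True
          then have "norm y powr a \<le> 1 powr a" using that by (intro powr_mono2) (auto simp: S_def)
          then show ?thesis by (simp add: add_increasing2)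
        next
          case False
          then have "norm y powr a \<le> (1 / 2) powr a" using that by (intro powr_mono2') (auto simp: S_def)
          then show ?thesis by simp
        qed
        then show ?thesis using radial_extension_nonneg[of y] by (simp add: mult.commute mult_left_mono)
      qed
      then have "F y \<le> ennreal (1 + (1 / 2) powr a) * ennreal (radial_extension m y)" if "y \<in> S 1"
        using that by (simp only: F_def radial_extension_nonneg add_nonneg_nonneg powr_ge_zero zero_le_one
            ennreal_leI flip: ennreal_mult)
      then show "F y * indicator (S 1) y \<le>
          ennreal (1 + (1 / 2) powr a) * (ennreal (radial_extension m y) * indicator (cball 0 1) y)"
        by (cases "y \<in> S 1") (auto simp: indicator_def S_def)
    qed
    also have "\<dots> = ennreal (1 + (1 / 2) powr a) * (\<integral>\<^sup>+y. ennreal (radial_extension m y) * indicator (cball 0 1) y \<partial>lborel)"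
      by (rule nn_integral_cmult) measurable
    also have "\<dots> < \<infinity>"
    proof -
      have "(\<integral>\<^sup>+y. ennreal (radial_extension m y) * indicator (cball 0 1) y \<partial>lborel) \<noteq> \<infinity>"
        using nn_integral_radial_extension_cball by (auto simp: ennreal_mult_top)
      then show ?thesis by (simp add: ennreal_mult_less_top less_top)
    qed
    finally show ?thesis .
  qed
  have "(\<integral>\<^sup>+y. F y * indicator (\<Union>n. S (\<rho> ^ n)) y \<partial>lborel) \<le> (\<integral>\<^sup>+y. (\<Sum>n. F y * indicator (S (\<rho> ^ n)) y) \<partial>lborel)"
  proof (intro nn_integral_mono)
    fix y :: 'a
    show "F y * indicator (\<Union>n. S (\<rho> ^ n)) y \<le> (\<Sum>n. F y * indicator (S (\<rho> ^ n)) y)"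
    proof (cases "y \<in> (\<Union>n. S (\<rho> ^ n))")
      case True
      then obtain n where n: "y \<in> S (\<rho> ^ n)" by auto
      then show ?thesis using sum_le_suminf[of "\<lambda>n. F y * indicator (S (\<rho> ^ n)) y" "{n}"] True by simp
    qed simp
  qed
  also have "\<dots> = (\<Sum>n. I (\<rho> ^ n))"
    unfolding I_def by (rule nn_integral_suminf) measurable
  also have "\<dots> = (\<Sum>n. ennreal ((\<rho> powr (real DIM('a) + a)) ^ n) * I 1)"
  proof (intro arg_cong[where f = suminf] ext)
    fix n
    have "(\<rho> ^ n) powr (real DIM('a) + a) = (\<rho> powr (real DIM('a) + a)) ^ n"
      using \<rho> by (simp add: powr_powr mult.commute flip: powr_realpow)
    then show "I (\<rho> ^ n) = ennreal ((\<rho> powr (real DIM('a) + a)) ^ n) * I 1"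
      using scaling[of "\<rho> ^ n"] \<rho> by simp
  qed
  also have "\<dots> = (\<Sum>n. ennreal ((\<rho> powr (real DIM('a) + a)) ^ n)) * I 1"
    by (rule ennreal_suminf_multc)
  also have "\<dots> < \<infinity>"
    using \<rho> I_1 by (subst suminf_ennreal2)
      (auto simp: ennreal_mult_less_top intro!: summable_geometric)
  finally show ?thesis unfolding S_def F_def .
qed

lemma nn_integral_small_jumps_finite:
  assumes "\<alpha> < p"
  shows "(\<integral>\<^sup>+y. ennreal (radial_extension m y * norm y powr (p - (real DIM('a) + \<alpha>))) *
     indicator (ball 0 1) y \<partial>lborel) < \<infinity>"
proof -
  have "(\<integral>\<^sup>+y. ennreal (radial_extension m y * norm y powr (p - (real DIM('a) + \<alpha>))) *
     indicator (ball 0 1) y \<partial>lborel) \<le>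
     (\<integral>\<^sup>+y. ennreal (radial_extension m y * norm y powr (p - (real DIM('a) + \<alpha>))) *
           indicator (\<Union>n. {y. (1 / 2) ^ n / 2 < norm y \<and> norm y \<le> (1 / 2) ^ n}) y \<partial>lborel)"
  proof (intro nn_integral_mono)
    fix y :: 'a
    have "\<exists>n. (1 / 2) ^ n / 2 < norm y \<and> norm y \<le> (1 / 2) ^ n" if "y \<noteq> 0" "norm y < 1"
    proof -
      have "\<exists>k. (1 / 2) ^ k < norm y" using real_arch_pow_inv[of "norm y" "1 / 2"] that by auto
      then obtain k where k: "(1 / 2) ^ k < norm y" ..
      define n where "n = (LEAST k. (1 / 2 :: real) ^ k < norm y)"
      have n: "(1 / 2) ^ n < norm y" unfolding n_def by (rule LeastI[of _ k]) (rule k)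
      then have "n \<noteq> 0" using that by (intro notI) simp
      then obtain n' where n': "n = Suc n'" by (auto simp: gr0_conv_Suc)
      have "\<not> (1 / 2) ^ n' < norm y"
        by (rule not_less_Least) (simp add: n' flip: n_def)
      with n n' show ?thesis by (intro exI[of _ n']) auto
    qed
    then show "ennreal (radial_extension m y * norm y powr (p - (real DIM('a) + \<alpha>))) * indicator (ball 0 1) y
      \<le> ennreal (radial_extension m y * norm y powr (p - (real DIM('a) + \<alpha>))) *
           indicator (\<Union>n. {y. (1 / 2) ^ n / 2 < norm y \<and> norm y \<le> (1 / 2) ^ n}) y"
      by (cases "y = 0") (auto simp: indicator_def)
  qed
  also have "\<dots> < \<infinity>"
  proof (intro nn_integral_radial_shells_finite)
    show "(1 / 2) powr (real DIM('a) + (p - (real DIM('a) + \<alpha>))) < (1 :: real)"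
      using assms by (simp add: powr_def ln_div)
  qed simp
  finally show ?thesis .
qed

lemma nn_integral_large_jumps_finite:
  assumes "0 < \<alpha>"
  shows "(\<integral>\<^sup>+y. ennreal (radial_extension m y * norm y powr (- (real DIM('a) + \<alpha>))) *
     indicator (- ball 0 1) y \<partial>lborel) < \<infinity>"
proof -
  have "(\<integral>\<^sup>+y. ennreal (radial_extension m y * norm y powr (- (real DIM('a) + \<alpha>))) *
     indicator (- ball 0 1) y \<partial>lborel) \<le>
     (\<integral>\<^sup>+y. ennreal (radial_extension m y * norm y powr (- (real DIM('a) + \<alpha>))) *
           indicator (\<Union>n. {y. 2 ^ n / 2 < norm y \<and> norm y \<le> 2 ^ n}) y \<partial>lborel)"
  proof (intro nn_integral_mono)
    fix y :: 'a
    have "\<exists>n. 2 ^ n / 2 < norm y \<and> norm y \<le> 2 ^ n" if "1 \<le> norm y"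
    proof -
      obtain k where k: "norm y < 2 ^ k" using real_arch_pow[of 2 "norm y"] by auto
      define n where "n = (LEAST k. norm y \<le> 2 ^ k)"
      have n: "norm y \<le> 2 ^ n" unfolding n_def by (rule LeastI[of _ k]) (rule less_imp_le[OF k])
      have "2 ^ n / 2 < norm y"
      proof (cases n)
        case (Suc n')
        have "\<not> norm y \<le> 2 ^ n'"
          by (rule not_less_Least) (simp add: Suc flip: n_def)
        with Suc show ?thesis by simp
      qed (use that in simp)
      with n show ?thesis by auto
    qed
    then show "ennreal (radial_extension m y * norm y powr (- (real DIM('a) + \<alpha>))) * indicator (- ball 0 1) y
      \<le> ennreal (radial_extension m y * norm y powr (- (real DIM('a) + \<alpha>))) *
           indicator (\<Union>n. {y. 2 ^ n / 2 < norm y \<and> norm y \<le> 2 ^ n}) y"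
      by (auto simp: indicator_def)
  qed
  also have "\<dots> < \<infinity>"
    using assms powr_less_cancel_iff[of 2 "- \<alpha>" 0] by (intro nn_integral_radial_shells_finite) auto
  finally show ?thesis .
qed

end

text \<open>
  The parameters of a tempered stable process.
\<close>

locale tempered_stable_parameters = sphere_density m for m :: "'a::euclidean_space \<Rightarrow> real" +
  fixes c \<alpha> lam :: real
  assumes \<alpha>: "\<alpha> \<in> {0<..<1} \<union> {1<..<2}" and lam_pos: "0 < lam" and c_pos: "0 < c"
begin

text \<open>
  The jump measure of the tempered stable process.
\<close>

definition jump_measure :: "'a measure" where
  "jump_measure = density lborel (\<lambda>y. ennreal (c * tempered_stable_density m \<alpha> lam y))"

lemma sets_jump_measure [simp, measurable_cong]: "sets jump_measure = sets borel"
  by (simp add: jump_measure_def)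

lemma borel_measurable_tempered_stable_density [measurable]:
  "tempered_stable_density m \<alpha> lam \<in> borel_measurable borel"
  unfolding tempered_stable_density_eq[abs_def] by measurable

lemma tempered_stable_density_nonneg: "0 \<le> tempered_stable_density m \<alpha> lam y"
  by (simp add: tempered_stable_density_eq radial_extension_nonneg)

lemma integrable_jump_measure:
  fixes f :: "'a \<Rightarrow> real"
  assumes [measurable]: "f \<in> borel_measurable borel" "B \<in> sets borel" and "\<And>y. 0 \<le> f y"
    and le: "\<And>y. y \<noteq> 0 \<Longrightarrow> f y * tempered_stable_density m \<alpha> lam y \<le>
        radial_extension m y * norm y powr a * indicator B y"
    and fin: "(\<integral>\<^sup>+y. ennreal (radial_extension m y * norm y powr a) * indicator B y \<partial>lborel) < \<infinity>"
  shows "integrable jump_measure f"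
proof (rule integrableI_nonneg)
  have "(\<integral>\<^sup>+y. ennreal (f y) \<partial>jump_measure) =
      (\<integral>\<^sup>+y. ennreal (c * (f y * tempered_stable_density m \<alpha> lam y)) \<partial>lborel)"
    unfolding jump_measure_def using c_pos tempered_stable_density_nonneg assms
    by (subst nn_integral_density) (auto simp: mult_ac simp flip: ennreal_mult)
  also have "\<dots> \<le> (\<integral>\<^sup>+y. ennreal c * (ennreal (radial_extension m y * norm y powr a) * indicator B y) \<partial>lborel)"
  proof (intro nn_integral_mono)
    fix y :: 'a
    have "f y * tempered_stable_density m \<alpha> lam y \<le> radial_extension m y * norm y powr a * indicator B y"
      by (cases "y = 0") (use le[of y] in \<open>simp_all add: tempered_stable_density_def radial_extension_def\<close>)
    then have "ennreal (c * (f y * tempered_stable_density m \<alpha> lam y)) \<le>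
        ennreal (c * (radial_extension m y * norm y powr a * indicator B y))"
      using c_pos by (intro ennreal_leI mult_left_mono) auto
    also have "\<dots> = ennreal c * (ennreal (radial_extension m y * norm y powr a) * indicator B y)"
      using c_pos radial_extension_nonneg[of y] by (auto simp: ennreal_mult indicator_def)
    finally show "ennreal (c * (f y * tempered_stable_density m \<alpha> lam y)) \<le>
      ennreal c * (ennreal (radial_extension m y * norm y powr a) * indicator B y)" .
  qed
  also have "\<dots> = ennreal c * (\<integral>\<^sup>+y. ennreal (radial_extension m y * norm y powr a) * indicator B y \<partial>lborel)"
    by (rule nn_integral_cmult) measurable
  also have "\<dots> < \<infinity>" using fin by (simp add: ennreal_mult_less_top)
  finally show "(\<integral>\<^sup>+y. ennreal (f y) \<partial>jump_measure) < \<infinity>" .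
qed (use assms in auto)

lemma integrable_small_jumps:
  assumes "\<alpha> < p"
  shows "integrable jump_measure (\<lambda>y. indicator (ball 0 1) y * norm y powr p)"
proof (rule integrable_jump_measure[OF _ _ _ _ nn_integral_small_jumps_finite[OF assms]])
  show "(\<lambda>y::'a. indicator (ball 0 1) y * norm y powr p) \<in> borel_measurable borel" by measurable
  fix y :: 'a assume y: "y \<noteq> 0"
  have "indicator (ball 0 1) y * norm y powr p * tempered_stable_density m \<alpha> lam y =
    radial_extension m y * norm y powr (p - (real DIM('a) + \<alpha>)) * indicator (ball 0 1) y * exp (- lam * norm y)"
    using y by (simp add: tempered_stable_density_eq powr_diff exp_minus field_simps)
  also have "\<dots> \<le> radial_extension m y * norm y powr (p - (real DIM('a) + \<alpha>)) * indicator (ball 0 1) y"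
    using lam_pos radial_extension_nonneg[of y] by (intro mult_left_le) auto
  finally show "indicator (ball 0 1) y * norm y powr p * tempered_stable_density m \<alpha> lam y \<le>
    radial_extension m y * norm y powr (p - (real DIM('a) + \<alpha>)) * indicator (ball 0 1) y" .
qed auto

lemma exp_levy_measure_jump_measure: "exp_levy_measure jump_measure lam"
proof
  have "integrable jump_measure (\<lambda>y. indicator (ball 0 1) y * norm y powr 2)"
    using \<alpha> by (intro integrable_small_jumps) auto
  then show "integrable jump_measure (\<lambda>y. indicator (ball 0 1) y * (norm y)\<^sup>2)" by simp
  show "integrable jump_measure (\<lambda>y. indicator (- ball 0 1) y * exp (lam * norm y))"
  proof (rule integrable_jump_measure[OF _ _ _ _ nn_integral_large_jumps_finite])
    have [measurable]: "- ball (0 :: 'a) 1 \<in> sets borel" by (simp add: sets.compl_sets)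
    show "(\<lambda>y::'a. indicator (- ball 0 1) y * exp (lam * norm y)) \<in> borel_measurable borel" by measurable
    fix y :: 'a assume y: "y \<noteq> 0"
    show "indicator (- ball 0 1) y * exp (lam * norm y) * tempered_stable_density m \<alpha> lam y \<le>
      radial_extension m y * norm y powr (- (real DIM('a) + \<alpha>)) * indicator (- ball 0 1) y"
      unfolding powr_minus using y by (simp add: tempered_stable_density_eq field_simps)
  qed (use \<alpha> in auto)
  show "emeasure jump_measure (- {0}) \<noteq> 0"
  proof
    assume "emeasure jump_measure (- {0}) = 0"
    then have "(\<integral>\<^sup>+y. ennreal (c * tempered_stable_density m \<alpha> lam y) * indicator (- {0}) y \<partial>lborel) = 0"
      by (simp add: jump_measure_def emeasure_density)
    then have "AE y in lborel. ennreal (c * tempered_stable_density m \<alpha> lam y) * indicator (- {0}) y = 0"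
      by (subst (asm) nn_integral_0_iff_AE) auto
    then have "AE y in lborel. ennreal (radial_extension m y) * indicator (cball 0 1) y = 0"
    proof eventually_elim
      fix y assume *: "ennreal (c * tempered_stable_density m \<alpha> lam y) * indicator (- {0}) y = 0"
      show "ennreal (radial_extension m y) * indicator (cball 0 1) y = 0"
      proof (cases "y = 0")
        case False
        with * have "c * tempered_stable_density m \<alpha> lam y \<le> 0" by (simp add: ennreal_eq_0_iff)
        then have "tempered_stable_density m \<alpha> lam y = 0"
          using c_pos tempered_stable_density_nonneg[of y] by (simp add: mult_le_0_iff)
        then show ?thesis using False by (simp add: tempered_stable_density_eq)
      qed (simp add: radial_extension_def)
    qed
    moreover have "(\<lambda>y. ennreal (radial_extension m y) * indicator (cball 0 1) y) \<in> borel_measurable lborel"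
      by measurable
    ultimately have "(\<integral>\<^sup>+y. ennreal (radial_extension m y) * indicator (cball 0 1) y \<partial>lborel) = 0"
      by (simp only: nn_integral_0_iff_AE)
    then show False using nn_integral_radial_extension_cball by simp
  qed
qed (use lam_pos in auto)

text \<open>
  Both forms of the exponent are Levy--Khintchine exponents of the jump measure.  For \<open>\<alpha> < 1\<close> the drift is
  the mean of the small jumps, which is finite in this case.
\<close>

lemma levy_exponent_jump_measure:
  obtains b where "\<And>k. tempered_stable_exponent m c \<alpha> lam k = levy_exponent jump_measure b k"
proof -
  interpret L: exp_levy_measure jump_measure lam by (rule exp_levy_measure_jump_measure)
  have eq: "of_real c * (LINT y:- {0}|lborel. g y * of_real (tempered_stable_density m \<alpha> lam y)) =
      (\<integral>y. g y \<partial>jump_measure)" if [measurable]: "g \<in> borel_measurable borel" for g :: "'a \<Rightarrow> complex"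
  proof -
    have "(\<integral>y. g y \<partial>jump_measure) = (\<integral>y. (c * tempered_stable_density m \<alpha> lam y) *\<^sub>R g y \<partial>lborel)"
      unfolding jump_measure_def using c_pos tempered_stable_density_nonneg
      by (subst integral_density) auto
    also have "\<dots> = (\<integral>y. of_real c * (indicator (- {0}) y *\<^sub>R (g y * of_real (tempered_stable_density m \<alpha> lam y))) \<partial>lborel)"
      by (intro Bochner_Integration.integral_cong)
        (auto simp: indicator_def scaleR_conv_of_real tempered_stable_density_def)
    finally show ?thesis unfolding set_lebesgue_integral_def by (simp only: integral_mult_right_zero)
  qed
  show thesis
  proof (cases "\<alpha> < 1")
    case True
    define b where "b = (\<integral>y. indicator (ball 0 1) y *\<^sub>R y \<partial>jump_measure)"
    have int: "integrable jump_measure (\<lambda>y. indicator (ball 0 1) y *\<^sub>R y)"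
    proof (rule Bochner_Integration.integrable_bound[OF integrable_small_jumps[OF True]])
      show "(\<lambda>y::'a. indicator (ball 0 1) y *\<^sub>R y) \<in> borel_measurable jump_measure" by measurable
    qed (auto simp: indicator_def)
    have "tempered_stable_exponent m c \<alpha> lam k = levy_exponent jump_measure b k" for k
    proof -
      have int_k: "integrable jump_measure (\<lambda>y. complex_of_real ((k \<bullet> y) * indicator (ball 0 1) y))"
        using integrable_inner_right[OF int, of k] by (intro integrable_of_real) (simp add: mult.commute)
      have "of_real (b \<bullet> k) = (\<integral>y. complex_of_real ((k \<bullet> y) * indicator (ball 0 1) y) \<partial>jump_measure)"
        unfolding b_def using int
        by (simp add: mult.commute inner_commute del: of_real_mult flip: integral_inner_right)
      then have "levy_exponent jump_measure b k =
         (\<integral>y. (iexp (k \<bullet> y) - 1 - \<i> * of_real ((k \<bullet> y) * indicator (ball 0 1) y)) +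
           \<i> * of_real ((k \<bullet> y) * indicator (ball 0 1) y) \<partial>jump_measure)"
        unfolding levy_exponent_def using L.integrable_levy_integrand[of k] int_k
        by (subst Bochner_Integration.integral_add) (auto simp del: of_real_mult)
      also have "\<dots> = (\<integral>y. iexp (k \<bullet> y) - 1 \<partial>jump_measure)" by simp
      also have "\<dots> = tempered_stable_exponent m c \<alpha> lam k"
        using True by (simp add: tempered_stable_exponent_def flip: eq)
      finally show ?thesis ..
    qed
    then show thesis by (rule that)
  next
    case False
    define b where "b = (c * Gamma (1 - \<alpha>) * lam powr (\<alpha> - 1)) *\<^sub>R sphere_mean m"
    have ball: "{y::'a. norm y < 1} = ball 0 1" by auto
    have "tempered_stable_exponent m c \<alpha> lam k = levy_exponent jump_measure b k" for k
    proof -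
      have "(\<lambda>y. iexp (k \<bullet> y) - 1 - \<i> * of_real ((k \<bullet> y) * indicator (ball 0 1) y)) \<in> borel_measurable borel"
        by measurable
      from eq[OF this] False show ?thesis
        by (simp add: tempered_stable_exponent_def levy_exponent_def ball b_def mult_ac)
    qed
    then show thesis by (rule that)
  qed
qed

end

section \<open>Exit of a random walk from a ball\<close>

text \<open>
  A random walk from a point of the ball, with independent steps \<open>\<xi> i\<close> that are grouped into blocks of
  \<open>L\<close> steps.  The exponential moments over at most \<open>L\<close> steps are bounded by \<open>C\<close>, and the displacement
  over a block exceeds the diameter of the ball with probability at least \<open>1 - q\<close>.
\<close>

locale walk_in_ball = prob_space M for M :: "'w measure" +
  fixes \<xi> :: "nat \<Rightarrow> 'w \<Rightarrow> 'a::euclidean_space" and L :: nat and x\<^sub>0 :: 'a and lam r C q :: real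
  assumes indep: "\<And>n. indep_vars (\<lambda>_. borel) \<xi> {..<n}"
    and L: "0 < L" and lam: "0 \<le> lam" and x0: "x\<^sub>0 \<in> cball 0 r" and q: "0 \<le> q" "q < 1" and C: "0 < C"
    and moment: "\<And>j k. j \<le> k \<Longrightarrow> k \<le> j + L \<Longrightarrow>
      (\<integral>\<^sup>+\<omega>. ennreal (exp (lam * norm (\<Sum>i\<in>{j..<k}. \<xi> i \<omega>))) \<partial>M) \<le> ennreal C"
    and escape: "\<And>n. \<P>(\<omega> in M. norm (\<Sum>i\<in>{n * L..<n * L + L}. \<xi> i \<omega>) \<le> 2 * r) \<le> q"
begin

text \<open>
  The position of the walk after \<open>j\<close> steps.
\<close>

definition S :: "nat \<Rightarrow> 'w \<Rightarrow> 'a" where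
  "S j \<omega> = x\<^sub>0 + (\<Sum>i<j. \<xi> i \<omega>)"

abbreviation g :: "'a \<Rightarrow> ennreal" where
  "g x \<equiv> ennreal (exp (lam * norm x))"

lemma random_variable_\<xi> [measurable]: "random_variable borel (\<xi> i)"
  using indep[of "Suc i"] by (auto simp: indep_vars_def)

lemma random_variable_S [measurable]: "random_variable borel (S j)"
  unfolding S_def[abs_def] by measurable

lemma S_diff: "j \<le> k \<Longrightarrow> S k \<omega> - S j \<omega> = (\<Sum>i\<in>{j..<k}. \<xi> i \<omega>)"
  using sum.atLeastLessThan_concat[of 0 j k "\<lambda>i. \<xi> i \<omega>"]
  by (simp add: S_def atLeast0LessThan algebra_simps)

lemma g_add_le: "g (x + y) \<le> g x * g y"
  using lam mult_left_mono[OF norm_triangle_ineq[of x y], of lam]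
  by (simp add: ennreal_leI distrib_left flip: ennreal_mult exp_add)

text \<open>
  A functional of the first \<open>j\<close> steps is independent of the increment from \<open>j\<close> to \<open>k\<close>.
\<close>

lemma nn_integral_past_future:
  fixes f :: "(nat \<Rightarrow> 'a) \<Rightarrow> ennreal" and h :: "'a \<Rightarrow> ennreal"
  assumes f: "f \<in> borel_measurable (PiM {..<j} (\<lambda>_. borel))" and h [measurable]: "h \<in> borel_measurable borel"
    and jk: "j \<le> k"
  shows "(\<integral>\<^sup>+\<omega>. f (\<lambda>i\<in>{..<j}. \<xi> i \<omega>) * h (S k \<omega> - S j \<omega>) \<partial>M) =
         (\<integral>\<^sup>+\<omega>. f (\<lambda>i\<in>{..<j}. \<xi> i \<omega>) \<partial>M) * (\<integral>\<^sup>+\<omega>. h (S k \<omega> - S j \<omega>) \<partial>M)"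
proof -
  have "indep_var (PiM {..<j} (\<lambda>_. borel)) (\<lambda>\<omega>. \<lambda>i\<in>{..<j}. \<xi> i \<omega>)
      (PiM {j..<k} (\<lambda>_. borel)) (\<lambda>\<omega>. \<lambda>i\<in>{j..<k}. \<xi> i \<omega>)"
    using jk by (intro indep_var_restrict[OF indep[of k]]) auto
  then have "indep_var borel (f \<circ> (\<lambda>\<omega>. \<lambda>i\<in>{..<j}. \<xi> i \<omega>))
      borel ((\<lambda>z. h (\<Sum>i\<in>{j..<k}. z i)) \<circ> (\<lambda>\<omega>. \<lambda>i\<in>{j..<k}. \<xi> i \<omega>))"
    by (rule indep_var_compose) (use f in measurable)
  then have ind: "indep_var borel (\<lambda>\<omega>. f (\<lambda>i\<in>{..<j}. \<xi> i \<omega>)) borel (\<lambda>\<omega>. h (\<Sum>i\<in>{j..<k}. \<xi> i \<omega>))"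
  proof -
    have "(\<Sum>i\<in>{j..<k}. (\<lambda>i\<in>{j..<k}. \<xi> i \<omega>) i) = (\<Sum>i\<in>{j..<k}. \<xi> i \<omega>)" for \<omega>
      by (intro sum.cong) auto
    with this show ?thesis
      using \<open>indep_var borel (f \<circ> _) borel _\<close> by (simp only: comp_def)
  qed
  let ?Z = "case_bool (\<lambda>\<omega>. f (\<lambda>i\<in>{..<j}. \<xi> i \<omega>)) (\<lambda>\<omega>. h (\<Sum>i\<in>{j..<k}. \<xi> i \<omega>))"
  have "indep_vars (\<lambda>_. borel) ?Z UNIV"
    using ind unfolding indep_var_def by (rule indep_vars_cong[THEN iffD1, rotated -1]) (auto split: bool.splits)
  then have "(\<integral>\<^sup>+\<omega>. (\<Prod>b\<in>UNIV. ?Z b \<omega>) \<partial>M) = (\<Prod>b\<in>UNIV. \<integral>\<^sup>+\<omega>. ?Z b \<omega> \<partial>M)"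
    by (intro indep_vars_nn_integral) auto
  then show ?thesis by (simp add: UNIV_bool S_diff[OF jk] mult.commute)
qed

text \<open>
  The position after \<open>j\<close> steps as a function of the sequence \<open>z\<close> of steps.
\<close>

definition walk_of :: "nat \<Rightarrow> (nat \<Rightarrow> 'a) \<Rightarrow> 'a" where
  "walk_of j z = x\<^sub>0 + (\<Sum>i<j. z i)"

lemma measurable_walk_of: "j \<le> n \<Longrightarrow> walk_of j \<in> borel_measurable (PiM {..<n} (\<lambda>_. borel))"
  unfolding walk_of_def[abs_def] by (intro borel_measurable_add borel_measurable_sum) auto

lemma walk_of_\<xi>: "j \<le> n \<Longrightarrow> walk_of j (\<lambda>i\<in>{..<n}. \<xi> i \<omega>) = S j \<omega>"
  by (auto simp: walk_of_def S_def intro!: sum.cong)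

text \<open>
  The walk is in the ball at the beginning of the blocks \<open>0, ..., n\<close>.
\<close>

definition survive :: "nat \<Rightarrow> 'w set" where
  "survive n = {\<omega>\<in>space M. \<forall>i\<in>{..n}. S (i * L) \<omega> \<in> cball 0 r}"

lemma sets_survive [measurable]: "survive n \<in> events"
  unfolding survive_def by measurable

lemma nn_integral_survive_future:
  assumes [measurable]: "h \<in> borel_measurable borel"
  shows "(\<integral>\<^sup>+\<omega>. indicator (survive n) \<omega> * h (S (n * L + L) \<omega> - S (n * L) \<omega>) \<partial>M) =
     emeasure M (survive n) * (\<integral>\<^sup>+\<omega>. h (S (n * L + L) \<omega> - S (n * L) \<omega>) \<partial>M)"
proof -
  define f where "f = (indicator {z. \<forall>i\<in>{..n}. walk_of (i * L) z \<in> cball 0 r} :: (nat \<Rightarrow> 'a) \<Rightarrow> ennreal)"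
  have f: "f \<in> borel_measurable (PiM {..<n * L} (\<lambda>_. borel))"
  proof -
    have [measurable]: "walk_of (i * L) \<in> borel_measurable (PiM {..<n * L} (\<lambda>_. borel))" if "i \<in> {..n}" for i
      using that by (intro measurable_walk_of) auto
    show ?thesis unfolding f_def by (rule borel_measurable_indicator') measurable
  qed
  have f_eq: "f (\<lambda>i\<in>{..<n * L}. \<xi> i \<omega>) = indicator (survive n) \<omega>" if "\<omega> \<in> space M" for \<omega>
    using that by (auto simp: f_def survive_def indicator_def walk_of_\<xi>)
  have "(\<integral>\<^sup>+\<omega>. f (\<lambda>i\<in>{..<n * L}. \<xi> i \<omega>) \<partial>M) = (\<integral>\<^sup>+\<omega>. indicator (survive n) \<omega> \<partial>M)"
    by (intro nn_integral_cong f_eq)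
  moreover have "(\<integral>\<^sup>+\<omega>. f (\<lambda>i\<in>{..<n * L}. \<xi> i \<omega>) * h (S (n * L + L) \<omega> - S (n * L) \<omega>) \<partial>M) =
     (\<integral>\<^sup>+\<omega>. indicator (survive n) \<omega> * h (S (n * L + L) \<omega> - S (n * L) \<omega>) \<partial>M)"
    by (intro nn_integral_cong) (simp add: f_eq)
  ultimately show ?thesis
    using nn_integral_past_future[OF f assms, of "n * L + L"] by simp
qed

lemma emeasure_survive_le: "emeasure M (survive n) \<le> ennreal (q ^ n)"
proof (induction n)
  case 0
  show ?case by (simp add: emeasure_le_1)
next
  case (Suc n)
  define h where "h = (indicator (cball 0 (2 * r)) :: 'a \<Rightarrow> ennreal)"
  have [measurable]: "h \<in> borel_measurable borel" unfolding h_def by measurable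
  have "emeasure M (survive (Suc n)) = (\<integral>\<^sup>+\<omega>. indicator (survive (Suc n)) \<omega> \<partial>M)" by simp
  also have "\<dots> \<le> (\<integral>\<^sup>+\<omega>. indicator (survive n) \<omega> * h (S (n * L + L) \<omega> - S (n * L) \<omega>) \<partial>M)"
  proof (intro nn_integral_mono)
    fix \<omega> assume "\<omega> \<in> space M"
    show "indicator (survive (Suc n)) \<omega> \<le> indicator (survive n) \<omega> * h (S (n * L + L) \<omega> - S (n * L) \<omega>)"
    proof (cases "\<omega> \<in> survive (Suc n)")
      case True
      then have "norm (S (n * L) \<omega>) \<le> r" "norm (S (Suc n * L) \<omega>) \<le> r"
        by (force simp: survive_def)+
      then have "norm (S (n * L + L) \<omega> - S (n * L) \<omega>) \<le> 2 * r"
        using norm_triangle_ineq4[of "S (n * L + L) \<omega>" "S (n * L) \<omega>"] by (simp add: add.commute)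
      with True show ?thesis by (simp add: h_def survive_def)
    qed simp
  qed
  also have "\<dots> = emeasure M (survive n) * (\<integral>\<^sup>+\<omega>. h (S (n * L + L) \<omega> - S (n * L) \<omega>) \<partial>M)"
    by (rule nn_integral_survive_future) measurable
  also have "(\<integral>\<^sup>+\<omega>. h (S (n * L + L) \<omega> - S (n * L) \<omega>) \<partial>M) =
      (\<integral>\<^sup>+\<omega>. indicator {\<omega>\<in>space M. norm (\<Sum>i\<in>{n * L..<n * L + L}. \<xi> i \<omega>) \<le> 2 * r} \<omega> \<partial>M)"
    by (intro nn_integral_cong) (auto simp: h_def S_diff indicator_def)
  also have "\<dots> \<le> ennreal q"
    using escape[of n] by (simp add: emeasure_eq_measure ennreal_leI)
  finally have "emeasure M (survive (Suc n)) \<le> emeasure M (survive n) * ennreal q"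
    by (simp add: mult_left_mono)
  also have "\<dots> \<le> ennreal (q ^ n) * ennreal q" by (intro mult_right_mono Suc) auto
  also have "\<dots> = ennreal (q ^ Suc n)" using q by (simp add: mult.commute flip: ennreal_mult)
  finally show ?case .
qed

lemma AE_exit: "AE \<omega> in M. \<exists>n>0. S (n * L) \<omega> \<notin> cball 0 r"
proof -
  have lim: "(\<lambda>n. ennreal (q ^ n)) \<longlonglongrightarrow> ennreal 0"
    using q by (intro tendsto_ennrealI LIMSEQ_power_zero) auto
  have "emeasure M (\<Inter>n. survive n) \<le> 0"
  proof (rule LIMSEQ_le_const[OF lim[simplified]])
    show "\<exists>N. \<forall>n\<ge>N. emeasure M (\<Inter>n. survive n) \<le> ennreal (q ^ n)"
      by (intro exI[of _ 0] allI impI order_trans[OF _ emeasure_survive_le] emeasure_mono) auto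
  qed
  then have "(\<Inter>n. survive n) \<in> null_sets M" by (auto simp: null_sets_def)
  then have "AE \<omega> in M. \<omega> \<notin> (\<Inter>n. survive n)" by (rule AE_not_in)
  then show ?thesis
  proof (rule AE_mp, intro AE_I2 impI)
    fix \<omega> assume "\<omega> \<in> space M" "\<omega> \<notin> (\<Inter>n. survive n)"
    then obtain i where i: "S (i * L) \<omega> \<notin> cball 0 r" by (auto simp: survive_def)
    moreover have "i \<noteq> 0" using i x0 by (cases i) (auto simp: S_def)
    ultimately show "\<exists>n>0. S (n * L) \<omega> \<notin> cball 0 r" by blast
  qed
qed

text \<open>
  The walk is outside the ball after \<open>j\<close> steps for the first time, not counting the starting time.
\<close>

definition first_exit :: "nat \<Rightarrow> 'w set" where
  "first_exit j = {\<omega>\<in>space M. (\<forall>i\<in>{0<..<j}. S i \<omega> \<in> cball 0 r) \<and> S j \<omega> \<notin> cball 0 r}"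

lemma sets_first_exit [measurable]: "first_exit j \<in> events"
  unfolding first_exit_def by measurable

text \<open>
  The exit time \<open>j\<close> can be replaced by a later time \<open>k\<close> at the cost of a constant: the increment
  \<open>S k - S j\<close> is independent of the exit at \<open>j\<close>, and \<open>E[exp (- lam * |S k - S j|)] \<ge> 1 / C\<close>.
\<close>

lemma nn_integral_first_exit_le:
  assumes jk: "j \<le> k" "k \<le> j + L"
  shows "(\<integral>\<^sup>+\<omega>. g (S j \<omega>) * indicator (first_exit j) \<omega> \<partial>M) \<le>
     ennreal C * (\<integral>\<^sup>+\<omega>. g (S k \<omega>) * indicator (first_exit j) \<omega> \<partial>M)"
proof -
  define h where "h x = ennreal (exp (- lam * norm x))" for x :: 'a
  have [measurable]: "h \<in> borel_measurable borel" unfolding h_def by measurable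
  define f where "f z = g (walk_of j z) * indicator {z. (\<forall>i\<in>{0<..<j}. walk_of i z \<in> cball 0 r) \<and> walk_of j z \<notin> cball 0 r} z" for z
  have f: "f \<in> borel_measurable (PiM {..<j} (\<lambda>_. borel))"
  proof -
    have [measurable]: "walk_of i \<in> borel_measurable (PiM {..<j} (\<lambda>_. borel))" if "i \<in> {0<..<j}" for i
      using that by (intro measurable_walk_of) auto
    have [measurable]: "walk_of j \<in> borel_measurable (PiM {..<j} (\<lambda>_. borel))"
      by (intro measurable_walk_of) auto
    have "indicator {z. (\<forall>i\<in>{0<..<j}. walk_of i z \<in> cball 0 r) \<and> walk_of j z \<notin> cball 0 r} \<in>
      (borel_measurable (PiM {..<j} (\<lambda>_. borel)) :: ((nat \<Rightarrow> 'a) \<Rightarrow> ennreal) set)"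
      by (rule borel_measurable_indicator') measurable
    then show ?thesis unfolding f_def by measurable
  qed
  have f_eq: "f (\<lambda>i\<in>{..<j}. \<xi> i \<omega>) = g (S j \<omega>) * indicator (first_exit j) \<omega>" if "\<omega> \<in> space M" for \<omega>
    using that by (auto simp: f_def first_exit_def indicator_def walk_of_\<xi>)
  define I where "I = (\<integral>\<^sup>+\<omega>. g (S j \<omega>) * indicator (first_exit j) \<omega> \<partial>M)"
  define m where "m = (\<integral>\<^sup>+\<omega>. h (S k \<omega> - S j \<omega>) \<partial>M)"
  have "I * m = (\<integral>\<^sup>+\<omega>. g (S j \<omega>) * indicator (first_exit j) \<omega> * h (S k \<omega> - S j \<omega>) \<partial>M)"
    using nn_integral_past_future[OF f _ jk(1), of h]
    by (simp add: I_def m_def f_eq cong: nn_integral_cong)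
  also have "\<dots> \<le> (\<integral>\<^sup>+\<omega>. g (S k \<omega>) * indicator (first_exit j) \<omega> \<partial>M)"
  proof (intro nn_integral_mono)
    fix \<omega>
    have "lam * norm (S j \<omega>) \<le> lam * (norm (S k \<omega>) + norm (S k \<omega> - S j \<omega>))"
      using norm_triangle_sub[of "S j \<omega>" "S k \<omega>"] lam by (intro mult_left_mono) (auto simp: norm_minus_commute)
    then have "g (S j \<omega>) * h (S k \<omega> - S j \<omega>) \<le> g (S k \<omega>)"
      by (simp add: h_def ennreal_leI algebra_simps flip: ennreal_mult exp_add)
    then show "g (S j \<omega>) * indicator (first_exit j) \<omega> * h (S k \<omega> - S j \<omega>) \<le> g (S k \<omega>) * indicator (first_exit j) \<omega>"
      by (auto simp: indicator_def)
  qed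
  finally have Im: "I * m \<le> (\<integral>\<^sup>+\<omega>. g (S k \<omega>) * indicator (first_exit j) \<omega> \<partial>M)" .
  have "ennreal (1 / C) \<le> m"
  proof -
    have "ennreal (2 / C) = (\<integral>\<^sup>+\<omega>. ennreal (2 / C) \<partial>M)" by (simp add: emeasure_space_1)
    also have "\<dots> \<le> (\<integral>\<^sup>+\<omega>. h (S k \<omega> - S j \<omega>) + ennreal (1 / C\<^sup>2) * g (S k \<omega> - S j \<omega>) \<partial>M)"
    proof (intro nn_integral_mono)
      fix \<omega>
      define u where "u = exp (lam * norm (S k \<omega> - S j \<omega>))"
      have u: "0 < u" by (simp add: u_def)
      \<comment> \<open>the inequality of the means; integrated, it bounds the negative moment from below by the positive one\<close>
      have "2 / C \<le> inverse u + 1 / C\<^sup>2 * u"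
        using zero_le_power2[of "C - u"] C u by (simp add: power2_eq_square field_simps)
      moreover have "h (S k \<omega> - S j \<omega>) = ennreal (inverse u)" by (simp add: h_def u_def exp_minus)
      ultimately show "ennreal (2 / C) \<le> h (S k \<omega> - S j \<omega>) + ennreal (1 / C\<^sup>2) * g (S k \<omega> - S j \<omega>)"
        using u C by (simp add: u_def[symmetric] ennreal_leI flip: ennreal_mult ennreal_plus)
    qed
    also have "\<dots> = m + ennreal (1 / C\<^sup>2) * (\<integral>\<^sup>+\<omega>. g (S k \<omega> - S j \<omega>) \<partial>M)"
      unfolding m_def by (subst nn_integral_add) (auto simp: nn_integral_cmult)
    also have "\<dots> \<le> m + ennreal (1 / C\<^sup>2) * ennreal C"
      using moment[OF jk] by (intro add_left_mono mult_left_mono) (auto simp: S_diff jk)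
    also have "ennreal (1 / C\<^sup>2) * ennreal C = ennreal (1 / C)"
      using C by (simp add: power2_eq_square flip: ennreal_mult)
    finally have "ennreal (2 / C) \<le> m + ennreal (1 / C)" .
    moreover have "ennreal (2 / C) = ennreal (1 / C) + ennreal (1 / C)"
      using C by (simp flip: ennreal_plus)
    ultimately show ?thesis by (simp add: add.commute)
  qed
  then have "I * ennreal (1 / C) \<le> I * m" by (rule mult_left_mono) simp
  with Im have "ennreal C * (I * ennreal (1 / C)) \<le>
      ennreal C * (\<integral>\<^sup>+\<omega>. g (S k \<omega>) * indicator (first_exit j) \<omega> \<partial>M)"
    by (intro mult_left_mono) auto
  also have "ennreal C * (I * ennreal (1 / C)) = I * (ennreal C * ennreal (1 / C))" by (simp only: mult_ac)
  also have "ennreal C * ennreal (1 / C) = 1" using C by (simp flip: ennreal_mult)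
  finally show ?thesis by (simp add: I_def)
qed

text \<open>
  The contribution of the exits during block \<open>n\<close>: the position at the exit is replaced by that at the
  end \<open>e\<close> of the block.  The exits at different times are disjoint events
  contained in \<open>survive n\<close>, and the displacement over the block is independent of \<open>survive n\<close>.
\<close>

lemma nn_integral_block_le:
  "(\<Sum>j\<in>{n * L..<n * L + L}. \<integral>\<^sup>+\<omega>. g (S (Suc j) \<omega>) * indicator (first_exit (Suc j)) \<omega> \<partial>M) \<le>
     ennreal (C * C * exp (lam * r) * q ^ n)"
proof -
  define e where "e = n * L + L"
  have "(\<Sum>j\<in>{n * L..<n * L + L}. \<integral>\<^sup>+\<omega>. g (S (Suc j) \<omega>) * indicator (first_exit (Suc j)) \<omega> \<partial>M) \<le>
     (\<Sum>j\<in>{n * L..<n * L + L}. ennreal C * (\<integral>\<^sup>+\<omega>. g (S e \<omega>) * indicator (first_exit (Suc j)) \<omega> \<partial>M))"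
    by (intro sum_mono nn_integral_first_exit_le) (auto simp: e_def)
  also have "\<dots> = ennreal C * (\<integral>\<^sup>+\<omega>. g (S e \<omega>) * (\<Sum>j\<in>{n * L..<n * L + L}. indicator (first_exit (Suc j)) \<omega>) \<partial>M)"
    by (subst sum_distrib_left[symmetric], subst nn_integral_sum[symmetric], measurable)
      (simp only: sum_distrib_left)
  also have "\<dots> \<le> ennreal C * (\<integral>\<^sup>+\<omega>. ennreal (exp (lam * r)) * (indicator (survive n) \<omega> * g (S e \<omega> - S (n * L) \<omega>)) \<partial>M)"
  proof (intro mult_left_mono nn_integral_mono)
    fix \<omega> assume \<omega>: "\<omega> \<in> space M"
    show "g (S e \<omega>) * (\<Sum>j\<in>{n * L..<n * L + L}. indicator (first_exit (Suc j)) \<omega>) \<le>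
        ennreal (exp (lam * r)) * (indicator (survive n) \<omega> * g (S e \<omega> - S (n * L) \<omega>))"
    proof (cases "\<exists>j\<in>{n * L..<n * L + L}. \<omega> \<in> first_exit (Suc j)")
      case True
      then obtain j where j: "n * L \<le> j" "j < n * L + L" "\<omega> \<in> first_exit (Suc j)" by auto
      have "\<omega> \<in> first_exit (Suc j') \<longleftrightarrow> j' = j" for j'
        using j(3) by (cases j j' rule: linorder_cases) (auto simp: first_exit_def)
      then have "(\<Sum>j\<in>{n * L..<n * L + L}. indicator (first_exit (Suc j)) \<omega>) = (\<Sum>j'\<in>{n * L..<n * L + L}. if j' = j then 1 else (0::ennreal))"
        by (intro sum.cong) (auto simp: indicator_def)
      then have sum: "(\<Sum>j\<in>{n * L..<n * L + L}. indicator (first_exit (Suc j)) \<omega>) = (1 :: ennreal)"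
        using j by simp
      have in_ball: "S (i * L) \<omega> \<in> cball 0 r" if "i \<le> n" for i
      proof (cases "i * L = 0")
        case False
        moreover have "i * L < Suc j" using j(1) mult_le_mono1[OF that, of L] by linarith
        ultimately show ?thesis using j(3) by (simp add: first_exit_def)
      next
        case True
        show ?thesis unfolding True using x0 by (simp add: S_def)
      qed
      then have surv: "\<omega> \<in> survive n" using \<omega> by (simp add: survive_def)
      have "g (S e \<omega>) \<le> g (S (n * L) \<omega>) * g (S e \<omega> - S (n * L) \<omega>)"
        using g_add_le[of "S (n * L) \<omega>" "S e \<omega> - S (n * L) \<omega>"] by simp
      also have "\<dots> \<le> ennreal (exp (lam * r)) * g (S e \<omega> - S (n * L) \<omega>)"
        using in_ball[of n] lam by (intro mult_right_mono ennreal_leI) (auto simp: mult_left_mono)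
      finally show ?thesis using sum surv by simp
    qed simp
  qed auto
  also have "\<dots> = ennreal C * (ennreal (exp (lam * r)) * (emeasure M (survive n) * (\<integral>\<^sup>+\<omega>. g (S e \<omega> - S (n * L) \<omega>) \<partial>M)))"
    unfolding e_def by (subst nn_integral_cmult, measurable, subst nn_integral_survive_future) auto
  also have "\<dots> \<le> ennreal C * (ennreal (exp (lam * r)) * (ennreal (q ^ n) * ennreal C))"
    using moment[of "n * L" "n * L + L"]
    by (intro mult_left_mono mult_mono emeasure_survive_le) (auto simp: e_def S_diff)
  also have "\<dots> = ennreal (C * C * exp (lam * r) * q ^ n)"
    using C q by (simp add: mult_ac flip: ennreal_mult)
  finally show ?thesis .
qed

theorem exit_moment:
  "(\<integral>\<^sup>+\<omega>. (if \<exists>j>0. S j \<omega> \<notin> cball 0 r then g (S (LEAST j. 0 < j \<and> S j \<omega> \<notin> cball 0 r) \<omega>) else 0) \<partial>M) \<le>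
     ennreal (C * C * exp (lam * r) / (1 - q))"
proof -
  have "(\<integral>\<^sup>+\<omega>. (if \<exists>j>0. S j \<omega> \<notin> cball 0 r then g (S (LEAST j. 0 < j \<and> S j \<omega> \<notin> cball 0 r) \<omega>) else 0) \<partial>M) \<le>
     (\<integral>\<^sup>+\<omega>. (\<Sum>j. g (S (Suc j) \<omega>) * indicator (first_exit (Suc j)) \<omega>) \<partial>M)"
  proof (intro nn_integral_mono)
    fix \<omega> assume \<omega>: "\<omega> \<in> space M"
    show "(if \<exists>j>0. S j \<omega> \<notin> cball 0 r then g (S (LEAST j. 0 < j \<and> S j \<omega> \<notin> cball 0 r) \<omega>) else 0) \<le>
      (\<Sum>j. g (S (Suc j) \<omega>) * indicator (first_exit (Suc j)) \<omega>)"
    proof (cases "\<exists>j>0. S j \<omega> \<notin> cball 0 r")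
      case True
      define k where "k = (LEAST j. 0 < j \<and> S j \<omega> \<notin> cball 0 r)"
      have k: "0 < k" "S k \<omega> \<notin> cball 0 r" using LeastI_ex[OF True] by (auto simp: k_def)
      have "S i \<omega> \<in> cball 0 r" if "0 < i" "i < k" for i
        using not_less_Least[of i "\<lambda>j. 0 < j \<and> S j \<omega> \<notin> cball 0 r"] that by (auto simp: k_def)
      then have "\<omega> \<in> first_exit k" using k \<omega> by (simp add: first_exit_def)
      moreover obtain j where "k = Suc j" using k by (cases k) auto
      ultimately show ?thesis
        unfolding if_P[OF True] k_def[symmetric]
        using sum_le_suminf[of "\<lambda>j. g (S (Suc j) \<omega>) * indicator (first_exit (Suc j)) \<omega>" "{j}"] by simp
    next
      case False
      then show ?thesis by (simp only: if_False zero_le)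
    qed
  qed
  also have "\<dots> = (\<Sum>j. \<integral>\<^sup>+\<omega>. g (S (Suc j) \<omega>) * indicator (first_exit (Suc j)) \<omega> \<partial>M)"
    by (rule nn_integral_suminf) measurable
  also have "\<dots> \<le> ennreal (C * C * exp (lam * r) / (1 - q))"
  proof (rule suminf_le_const)
    fix N
    let ?T = "\<lambda>j. \<integral>\<^sup>+\<omega>. g (S (Suc j) \<omega>) * indicator (first_exit (Suc j)) \<omega> \<partial>M"
    have "sum ?T {..<N} \<le> sum ?T {..<N * L}"
      using L by (intro sum_mono2) (auto intro: less_le_trans)
    also have "\<dots> = (\<Sum>n<N. sum ?T {n * L..<n * L + L})"
      by (rule sum.nat_group[symmetric])
    also have "\<dots> \<le> (\<Sum>n<N. ennreal (C * C * exp (lam * r) * q ^ n))"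
      by (intro sum_mono nn_integral_block_le)
    also have "\<dots> = ennreal (C * C * exp (lam * r) * (\<Sum>n<N. q ^ n))"
      using C q by (subst sum_ennreal) (auto simp: sum_distrib_left)
    also have "\<dots> \<le> ennreal (C * C * exp (lam * r) * (1 / (1 - q)))"
      using C q sum_le_suminf[OF summable_geometric[of q], of "{..<N}"]
      by (intro ennreal_leI mult_left_mono) (auto simp: suminf_geometric)
    finally show "sum ?T {..<N} \<le> ennreal (C * C * exp (lam * r) / (1 - q))" by simp
  qed auto
  finally show ?thesis .
qed

end

section \<open>Exit of a Levy process from a ball\<close>

text \<open>
  The index of the first positive time outside \<open>B\<close> on the grid of width \<open>h\<close>; arbitrary if there is none.
\<close>

definition grid_exit :: "(real \<Rightarrow> 'w \<Rightarrow> 'a::topological_space) \<Rightarrow> 'a set \<Rightarrow> real \<Rightarrow> 'w \<Rightarrow> nat" where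
  "grid_exit X B h \<omega> = (LEAST j. 0 < j \<and> X (real j * h) \<omega> \<notin> B)"

text \<open>
  As the grid becomes finer, the first exit on the grid tends to the exit time from the right: a path
  that is outside the closed set \<open>B\<close> stays outside for a while.  Right continuity at the exit time does
  the rest.
\<close>

lemma grid_exit_tendsto:
  fixes X :: "real \<Rightarrow> 'w \<Rightarrow> 'a::topological_space"
  assumes cadlag: "cadlag (\<lambda>t. X t \<omega>)" and B: "closed B" and exit: "\<exists>t>0. X t \<omega> \<notin> B"
    and h: "\<And>n. 0 < h n" "h \<longlonglongrightarrow> 0"
  shows "exit_time X B \<omega> < \<infinity>"
    and "\<forall>\<^sub>F n in sequentially. \<exists>j>0. X (real j * h n) \<omega> \<notin> B"
    and "(\<lambda>n. X (real (grid_exit X B (h n) \<omega>) * h n) \<omega>) \<longlonglongrightarrow> exit_position X B \<omega>"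
proof -
  define A where "A = {t. 0 < t \<and> X t \<omega> \<notin> B}"
  have A: "A \<noteq> {}" "bdd_below A"
    using exit by (auto simp: A_def intro!: bdd_belowI[of _ 0])
  define \<tau> where "\<tau> = Inf A"
  have "exit_time X B \<omega> = Inf (ereal ` A)"
    unfolding exit_time_def A_def by (rule arg_cong[where f = Inf]) auto
  then have exit_time: "exit_time X B \<omega> = ereal \<tau>"
    using ereal_Inf'[OF A(2,1)] by (simp add: \<tau>_def)
  then show "exit_time X B \<omega> < \<infinity>" by simp
  have "0 \<le> \<tau>" unfolding \<tau>_def using A(1) by (rule cInf_greatest) (auto simp: A_def)
  then have right: "((\<lambda>t. X t \<omega>) \<longlongrightarrow> X \<tau> \<omega>) (at_right \<tau>)"
    using cadlag by (simp add: cadlag_def)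
  let ?E = "\<lambda>n j. 0 < j \<and> X (real j * h n) \<omega> \<notin> B"
  let ?s = "\<lambda>n. real (grid_exit X B (h n) \<omega>) * h n"
  have close: "\<forall>\<^sub>F n in sequentially. \<exists>j. ?E n j \<and> real j * h n < \<tau> + e" if "0 < e" for e
  proof -
    have "\<tau> < \<tau> + e" using that by simp
    then obtain t where t: "t \<in> A" "t < \<tau> + e"
      unfolding \<tau>_def using cInf_lessD[OF A(1)] by blast
    then have "((\<lambda>t. X t \<omega>) \<longlongrightarrow> X t \<omega>) (at_right t)"
      using cadlag by (simp add: A_def cadlag_def)
    then have "\<forall>\<^sub>F s in at_right t. X s \<omega> \<in> - B"
      by (rule topological_tendstoD) (use B t in \<open>auto simp: A_def\<close>)
    then obtain u where u: "t < u" "\<And>s. t < s \<Longrightarrow> s < u \<Longrightarrow> X s \<omega> \<notin> B"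
      unfolding eventually_at_right_field by auto
    define d where "d = min (u - t) (\<tau> + e - t)"
    have "0 < d" using u t by (simp add: d_def)
    with h(2) have "\<forall>\<^sub>F n in sequentially. h n < d" by (rule order_tendstoD)
    then show ?thesis
    proof eventually_elim
      fix n assume n: "h n < d"
      \<comment> \<open>the first grid point strictly to the right of \<open>t\<close>\<close>
      define j where "j = nat \<lfloor>t / h n\<rfloor> + 1"
      have "0 \<le> t / h n" using t h(1)[of n] by (simp add: A_def)
      then have "t / h n < real j" "real j \<le> t / h n + 1" unfolding j_def by linarith+
      then have "t < real j * h n" "real j * h n \<le> t + h n"
        using h(1)[of n] by (simp_all add: field_simps)
      then have "?E n j \<and> real j * h n < \<tau> + e"
        using n u(2)[of "real j * h n"] by (auto simp: d_def j_def)
      then show "\<exists>j. ?E n j \<and> real j * h n < \<tau> + e" ..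
    qed
  qed
  show "\<forall>\<^sub>F n in sequentially. \<exists>j>0. X (real j * h n) \<omega> \<notin> B"
    using close[of 1] by (auto elim!: eventually_mono)
  have s_close: "\<forall>\<^sub>F n in sequentially. \<tau> \<le> ?s n \<and> ?s n < \<tau> + e" if "0 < e" for e
    using close[OF that]
  proof eventually_elim
    fix n assume "\<exists>j. ?E n j \<and> real j * h n < \<tau> + e"
    then obtain j where j: "?E n j" "real j * h n < \<tau> + e" by blast
    have E: "?E n (grid_exit X B (h n) \<omega>)" unfolding grid_exit_def by (rule LeastI[of _ j]) (rule j)
    have "grid_exit X B (h n) \<omega> \<le> j" unfolding grid_exit_def by (rule Least_le) (rule j)
    then have "?s n \<le> real j * h n" using h(1)[of n] by simp
    moreover have "?s n \<in> A" using E h(1)[of n] by (simp add: A_def)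
    then have "\<tau> \<le> ?s n" unfolding \<tau>_def using A(2) by (intro cInf_lower)
    ultimately show "\<tau> \<le> ?s n \<and> ?s n < \<tau> + e" using j by simp
  qed
  have "(\<lambda>n. X (?s n) \<omega>) \<longlonglongrightarrow> X \<tau> \<omega>"
  proof (rule topological_tendstoI)
    fix U assume U: "open U" "X \<tau> \<omega> \<in> U"
    have "\<forall>\<^sub>F t in at_right \<tau>. X t \<omega> \<in> U" by (rule topological_tendstoD[OF right U])
    then obtain u where u: "\<tau> < u" "\<And>s. \<tau> < s \<Longrightarrow> s < u \<Longrightarrow> X s \<omega> \<in> U"
      unfolding eventually_at_right_field by auto
    then have "\<forall>\<^sub>F n in sequentially. \<tau> \<le> ?s n \<and> ?s n < \<tau> + (u - \<tau>)" by (intro s_close) simp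
    then show "\<forall>\<^sub>F n in sequentially. X (?s n) \<omega> \<in> U"
    proof eventually_elim
      fix n assume "\<tau> \<le> ?s n \<and> ?s n < \<tau> + (u - \<tau>)"
      then show "X (?s n) \<omega> \<in> U" using U(2) u(2)[of "?s n"] by (cases "?s n = \<tau>") auto
    qed
  qed
  then show "(\<lambda>n. X (?s n) \<omega>) \<longlonglongrightarrow> exit_position X B \<omega>"
    by (simp add: exit_position_def exit_time)
qed

lemma measurable_completion_AE_eq:
  assumes f: "f \<in> measurable M borel" and g: "AE x in M. g x = f x"
  shows "g \<in> borel_measurable (completion M)"
proof (rule measurableI)
  fix U :: "'b set" assume U: "U \<in> sets borel"
  have "f \<in> measurable (completion M) borel" using f by (rule measurable_completion)
  then have "f -` U \<inter> space (completion M) \<in> sets (completion M)" using U by (rule measurable_sets)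
  moreover have "AE x in completion M. x \<in> f -` U \<inter> space (completion M) \<longleftrightarrow> x \<in> g -` U \<inter> space (completion M)"
    using AE_completion[OF g] by eventually_elim auto
  ultimately show "g -` U \<inter> space (completion M) \<in> sets (completion M)"
    using completion.in_sets_AE by blast
qed simp

context levy_process
begin

lemma random_variable_increment [measurable]:
  "0 \<le> s \<Longrightarrow> 0 \<le> t \<Longrightarrow> random_variable borel (\<lambda>\<omega>. X t \<omega> - X s \<omega>)"
  by (intro borel_measurable_diff random_variable_X)

text \<open>
  The exit position is the limit of the exit positions on the dyadic grids of width \<open>T / 2 ^ n\<close>, whose
  exponential moments are bounded uniformly in \<open>n\<close> by the estimate for random walks; Fatou's lemma
  concludes.  The blocks of the walk are the time intervals of length \<open>T\<close>.
\<close>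

lemma integrable_exp_norm_exit_position:
  assumes lam: "0 < lam" and x: "x \<in> cball 0 r" and T: "0 < T"
    and C: "0 < C" and moment: "\<And>t. 0 \<le> t \<Longrightarrow> t \<le> T \<Longrightarrow>
      (\<integral>\<^sup>+\<omega>. ennreal (exp (lam * norm (X t \<omega> - X 0 \<omega>))) \<partial>M) \<le> ennreal C"
    and escape: "\<P>(\<omega> in M. norm (X T \<omega> - X 0 \<omega>) \<le> 2 * r) < 1"
    and \<beta>: "\<beta> \<le> lam"
  shows "AE \<omega> in M. exit_time X (cball 0 r) \<omega> < \<infinity>"
    and "integrable (completion M) (\<lambda>\<omega>. exp (\<beta> * norm (exit_position X (cball 0 r) \<omega>)))"
proof -
  define h where "h n = T / 2 ^ n" for n :: nat
  have h: "0 < h n" for n using T by (simp add: h_def)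
  have h_lim: "h \<longlonglongrightarrow> 0"
    unfolding h_def by (intro tendsto_divide_0[OF tendsto_const] filterlim_realpow_sequentially_gt1 filterlim_at_top_imp_at_infinity) simp
  define \<xi> where "\<xi> n i \<omega> = X (real (Suc i) * h n) \<omega> - X (real i * h n) \<omega>" for n i \<omega>
  define q where "q = \<P>(\<omega> in M. norm (X T \<omega> - X 0 \<omega>) \<le> 2 * r)"
  have telescope: "(\<Sum>i\<in>{j..<k}. \<xi> n i \<omega>) = X (real k * h n) \<omega> - X (real j * h n) \<omega>" if "j \<le> k" for n j k \<omega>
    unfolding \<xi>_def using sum_Suc_diff'[OF that, of "\<lambda>i. X (real i * h n) \<omega>"] by simp
  have increment: "(\<integral>\<^sup>+\<omega>. f (X (s + t) \<omega> - X s \<omega>) \<partial>M) = (\<integral>\<^sup>+\<omega>. f (X t \<omega> - X 0 \<omega>) \<partial>M)"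
    if f [measurable]: "f \<in> borel_measurable borel" and st: "0 \<le> s" "0 \<le> t" for f :: "'a \<Rightarrow> ennreal" and s t
  proof -
    have "(\<integral>\<^sup>+\<omega>. f (X (s + t) \<omega> - X s \<omega>) \<partial>M) = (\<integral>\<^sup>+y. f y \<partial>distr M borel (\<lambda>\<omega>. X (s + t) \<omega> - X s \<omega>))"
      using st by (subst nn_integral_distr) auto
    also have "\<dots> = (\<integral>\<^sup>+y. f y \<partial>distr M borel (\<lambda>\<omega>. X t \<omega> - X 0 \<omega>))"
      by (simp add: stationary_increments st)
    also have "\<dots> = (\<integral>\<^sup>+\<omega>. f (X t \<omega> - X 0 \<omega>) \<partial>M)"
      using st by (subst nn_integral_distr) auto
    finally show ?thesis .
  qed
  have walk: "walk_in_ball M (\<xi> n) (2 ^ n) x lam r C q" for n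
  proof
    show "indep_vars (\<lambda>_. borel) (\<xi> n) {..<N}" for N
      unfolding \<xi>_def[abs_def] using h[of n]
      by (intro independent_increments[of "\<lambda>i. real i * h n"]) (auto simp: mono_def)
    show "(\<integral>\<^sup>+\<omega>. ennreal (exp (lam * norm (\<Sum>i\<in>{j..<k}. \<xi> n i \<omega>))) \<partial>M) \<le> ennreal C"
      if jk: "j \<le> k" "k \<le> j + 2 ^ n" for j k
    proof -
      define t where "t = real (k - j) * h n"
      have "real (k - j) * h n \<le> real (2 ^ n) * h n"
        using jk h[of n] by (intro mult_right_mono) (simp_all del: of_nat_power)
      then have t: "0 \<le> t" "t \<le> T" using T h[of n] by (simp_all add: t_def h_def)
      have k: "real k * h n = real j * h n + t" using jk by (simp add: t_def of_nat_diff algebra_simps)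
      show ?thesis
        unfolding telescope[OF jk(1)] k using h[of n] t
        by (subst increment[of "\<lambda>y. ennreal (exp (lam * norm y))"]) (auto intro: moment)
    qed
    show "\<P>(\<omega> in M. norm (\<Sum>i\<in>{m * 2 ^ n..<m * 2 ^ n + 2 ^ n}. \<xi> n i \<omega>) \<le> 2 * r) \<le> q" for m
    proof -
      have eq: "real (m * 2 ^ n + 2 ^ n) * h n = real m * T + T" "real (m * 2 ^ n) * h n = real m * T"
        by (simp_all add: h_def field_simps)
      have "\<P>(\<omega> in M. norm (\<Sum>i\<in>{m * 2 ^ n..<m * 2 ^ n + 2 ^ n}. \<xi> n i \<omega>) \<le> 2 * r) =
          measure (distr M borel (\<lambda>\<omega>. X (real m * T + T) \<omega> - X (real m * T) \<omega>)) (cball 0 (2 * r))"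
        unfolding telescope[OF le_add1] eq using T
        by (subst measure_distr) (auto intro!: arg_cong[where f = "measure M"])
      also have "\<dots> = measure (distr M borel (\<lambda>\<omega>. X T \<omega> - X 0 \<omega>)) (cball 0 (2 * r))"
        using T by (simp add: stationary_increments)
      also have "\<dots> = q"
        unfolding q_def using T by (subst measure_distr) (auto intro!: arg_cong[where f = "measure M"])
      finally show ?thesis by simp
    qed
  qed (use lam x C escape in \<open>auto simp: q_def\<close>)
  have S_eq: "walk_in_ball.S (\<xi> n) x j \<omega> = X (real j * h n) \<omega>" if "X 0 \<omega> = x" for n j \<omega>
    using that telescope[of 0 j n \<omega>] by (simp add: walk_in_ball.S_def[OF walk] atLeast0LessThan)
  have "AE \<omega> in M. \<exists>t>0. X t \<omega> \<notin> cball 0 r"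
    using start walk_in_ball.AE_exit[OF walk[of 0]]
  proof eventually_elim
    fix \<omega> assume "X 0 \<omega> = x" "\<exists>n>0. walk_in_ball.S (\<xi> 0) x (n * 2 ^ 0) \<omega> \<notin> cball 0 r"
    then obtain n :: nat where "0 < n" "X (real n * h 0) \<omega> \<notin> cball 0 r" by (auto simp: S_eq)
    then show "\<exists>t>0. X t \<omega> \<notin> cball 0 r" using h[of 0] by (intro exI[of _ "real n * h 0"]) auto
  qed
  with cadlag_paths have good: "AE \<omega> in M. cadlag (\<lambda>t. X t \<omega>) \<and> (\<exists>t>0. X t \<omega> \<notin> cball 0 r)"
    by eventually_elim (rule conjI)
  note grid_exit = grid_exit_tendsto[where X = X and B = "cball 0 r" and h = h, OF _ closed_cball _ h h_lim]
  show "AE \<omega> in M. exit_time X (cball 0 r) \<omega> < \<infinity>"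
    using good by eventually_elim (elim conjE, rule grid_exit(1))
  define J where "J n \<omega> = grid_exit X (cball 0 r) (h n) \<omega>" for n \<omega>
  define W where "W n \<omega> = X (real (J n \<omega>) * h n) \<omega>" for n \<omega>
  have [measurable]: "random_variable borel (X (real j * h n))" for j n
    using h[of n] by (intro random_variable_X) simp
  have [measurable]: "J n \<in> measurable M (count_space UNIV)" for n
    unfolding J_def[abs_def] grid_exit_def by measurable
  have [measurable]: "random_variable borel (W n)" for n
    unfolding W_def[abs_def] by (rule measurable_compose_countable) measurable
  \<comment> \<open>a random variable that agrees almost surely with the exit position, whose measurability is only clear for the completion\<close>
  define P where "P \<omega> = lim (\<lambda>n. W n \<omega>)" for \<omega>
  have [measurable]: "random_variable borel P"
    unfolding P_def[abs_def] by measurable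
  have W_lim: "AE \<omega> in M. (\<lambda>n. W n \<omega>) \<longlonglongrightarrow> exit_position X (cball 0 r) \<omega>"
    using good unfolding W_def J_def by eventually_elim (elim conjE, rule grid_exit(3))
  then have P_eq: "AE \<omega> in M. exit_position X (cball 0 r) \<omega> = P \<omega>"
    unfolding P_def by eventually_elim (simp add: limI)
  define V where "V n \<omega> = (if \<exists>j>0. X (real j * h n) \<omega> \<notin> cball 0 r then ennreal (exp (lam * norm (W n \<omega>))) else 0)" for n \<omega>
  have [measurable]: "V n \<in> borel_measurable M" for n
    unfolding V_def[abs_def] by measurable
  have V_le: "(\<integral>\<^sup>+\<omega>. V n \<omega> \<partial>M) \<le> ennreal (C * C * exp (lam * r) / (1 - q))" for n
  proof -
    have "(\<integral>\<^sup>+\<omega>. V n \<omega> \<partial>M) = (\<integral>\<^sup>+\<omega>. (if \<exists>j>0. walk_in_ball.S (\<xi> n) x j \<omega> \<notin> cball 0 r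
        then ennreal (exp (lam * norm (walk_in_ball.S (\<xi> n) x
          (LEAST j. 0 < j \<and> walk_in_ball.S (\<xi> n) x j \<omega> \<notin> cball 0 r) \<omega>))) else 0) \<partial>M)"
    proof (rule nn_integral_cong_AE)
      show "AE \<omega> in M. V n \<omega> = (if \<exists>j>0. walk_in_ball.S (\<xi> n) x j \<omega> \<notin> cball 0 r
        then ennreal (exp (lam * norm (walk_in_ball.S (\<xi> n) x
          (LEAST j. 0 < j \<and> walk_in_ball.S (\<xi> n) x j \<omega> \<notin> cball 0 r) \<omega>))) else 0)"
        using start by eventually_elim (simp only: S_eq V_def W_def J_def grid_exit_def)
    qed
    also have "\<dots> \<le> ennreal (C * C * exp (lam * r) / (1 - q))"
      by (rule walk_in_ball.exit_moment[OF walk])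
    finally show ?thesis .
  qed
  have "(\<integral>\<^sup>+\<omega>. ennreal (exp (lam * norm (P \<omega>))) \<partial>M) \<le> (\<integral>\<^sup>+\<omega>. liminf (\<lambda>n. V n \<omega>) \<partial>M)"
  proof (rule nn_integral_mono_AE)
    show "AE \<omega> in M. ennreal (exp (lam * norm (P \<omega>))) \<le> liminf (\<lambda>n. V n \<omega>)"
      using good W_lim P_eq
    proof eventually_elim
      fix \<omega> assume *: "cadlag (\<lambda>t. X t \<omega>) \<and> (\<exists>t>0. X t \<omega> \<notin> cball 0 r)"
        and lim: "(\<lambda>n. W n \<omega>) \<longlonglongrightarrow> exit_position X (cball 0 r) \<omega>"
        and eq: "exit_position X (cball 0 r) \<omega> = P \<omega>"
      have "(\<lambda>n. ennreal (exp (lam * norm (W n \<omega>)))) \<longlonglongrightarrow> ennreal (exp (lam * norm (P \<omega>)))"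
        using lim unfolding eq by (intro tendsto_intros tendsto_ennrealI)
      moreover have "\<forall>\<^sub>F n in sequentially. ennreal (exp (lam * norm (W n \<omega>))) = V n \<omega>"
        using grid_exit(2)[OF conjunct1[OF *] conjunct2[OF *]] unfolding V_def by (auto elim!: eventually_mono)
      ultimately have "(\<lambda>n. V n \<omega>) \<longlonglongrightarrow> ennreal (exp (lam * norm (P \<omega>)))"
        by (rule Lim_transform_eventually)
      then show "ennreal (exp (lam * norm (P \<omega>))) \<le> liminf (\<lambda>n. V n \<omega>)"
        by (simp add: lim_imp_Liminf)
    qed
  qed
  also have "\<dots> \<le> liminf (\<lambda>n. \<integral>\<^sup>+\<omega>. V n \<omega> \<partial>M)"
    by (rule nn_integral_liminf) measurable
  also have "\<dots> \<le> ennreal (C * C * exp (lam * r) / (1 - q))"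
    using V_le by (intro Liminf_le) auto
  finally have P_moment: "(\<integral>\<^sup>+\<omega>. ennreal (exp (lam * norm (P \<omega>))) \<partial>M) \<le> ennreal (C * C * exp (lam * r) / (1 - q))" .
  have "integrable M (\<lambda>\<omega>. exp (\<beta> * norm (P \<omega>)))"
  proof (rule integrableI_nonneg)
    have "(\<integral>\<^sup>+\<omega>. ennreal (exp (\<beta> * norm (P \<omega>))) \<partial>M) \<le> (\<integral>\<^sup>+\<omega>. ennreal (exp (lam * norm (P \<omega>))) \<partial>M)"
      using \<beta> by (intro nn_integral_mono ennreal_leI) (simp add: mult_right_mono)
    also have "\<dots> < \<infinity>" using P_moment by (rule le_less_trans) simp
    finally show "(\<integral>\<^sup>+\<omega>. ennreal (exp (\<beta> * norm (P \<omega>))) \<partial>M) < \<infinity>" .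
  qed auto
  then have "integrable (completion M) (\<lambda>\<omega>. exp (\<beta> * norm (P \<omega>)))"
    by (subst integrable_completion) auto
  moreover have "AE \<omega> in M. exp (\<beta> * norm (exit_position X (cball 0 r) \<omega>)) = exp (\<beta> * norm (P \<omega>))"
    using P_eq by eventually_elim simp
  moreover from this have "(\<lambda>\<omega>. exp (\<beta> * norm (exit_position X (cball 0 r) \<omega>))) \<in> borel_measurable (completion M)"
    by (rule measurable_completion_AE_eq[rotated]) measurable
  ultimately show "integrable (completion M) (\<lambda>\<omega>. exp (\<beta> * norm (exit_position X (cball 0 r) \<omega>)))"
    by (subst integrable_cong_AE) (auto intro: AE_completion)
qed

end

theorem corollary6:
  fixes M :: "'w measure" and X :: "real \<Rightarrow> 'w \<Rightarrow> 'a::euclidean_space" and x\<^sub>0 :: 'a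
    and m :: "'a \<Rightarrow> real" and c \<alpha> lam r \<beta> :: real
  assumes "0 < r"
    and "\<alpha> \<in> {0<..<1} \<union> {1<..<2}"
    and "0 < lam"
    and "0 < c"
    and "sphere_prob_density m"
    and "tempered_stable_process M X x\<^sub>0 m c \<alpha> lam"
    and "x\<^sub>0 \<in> cball 0 r"
    and "\<beta> \<le> lam"
  shows "(AE \<omega> in M. exit_time X (cball 0 r) \<omega> < \<infinity>) \<and>
    integrable (completion M) (\<lambda>\<omega>. exp (\<beta> * norm (exit_position X (cball 0 r) \<omega>)))"
proof -
  interpret tempered_stable_process M X x\<^sub>0 m c \<alpha> lam by fact
  interpret N: tempered_stable_parameters m c \<alpha> lam by standard (use assms in auto)
  interpret L: exp_levy_measure N.jump_measure lam by (rule N.exp_levy_measure_jump_measure)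
  obtain b where b: "\<And>k. tempered_stable_exponent m c \<alpha> lam k = levy_exponent N.jump_measure b k"
    by (rule N.levy_exponent_jump_measure) blast
  define Y where "Y t = distr M borel (\<lambda>\<omega>. X t \<omega> - X 0 \<omega>)" for t
  have Y: "prob_space (Y t)" "sets (Y t) = sets borel"
    "\<And>k. (\<integral>y. iexp (k \<bullet> y) \<partial>Y t) = exp (of_real t * levy_exponent N.jump_measure b k)" if "0 \<le> t" for t
    using that characteristic_function[OF that] unfolding Y_def
    by (auto intro!: prob_space_distr simp: integral_distr b)
  obtain T where T: "0 < T" and escape: "measure (Y T) (cball 0 (2 * r)) < 1"
    using L.ex_time_not_confined[of "2 * r" b] Y assms(1) by (metis less_imp_le mult_nonneg_nonneg zero_le_numeral)
  obtain K where K: "\<And>t. 0 \<le> t \<Longrightarrow>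
      (\<integral>\<^sup>+y. ennreal (exp (lam * norm y)) \<partial>Y t) \<le> ennreal (K * exp (L.growth_rate b * t))"
    using L.exp_moment[of b] Y by metis
  define C where "C = 1 + \<bar>K\<bar> * exp (\<bar>L.growth_rate b\<bar> * T)"
  have moment: "(\<integral>\<^sup>+\<omega>. ennreal (exp (lam * norm (X t \<omega> - X 0 \<omega>))) \<partial>M) \<le> ennreal C" if t: "0 \<le> t" "t \<le> T" for t
  proof -
    have "(\<integral>\<^sup>+\<omega>. ennreal (exp (lam * norm (X t \<omega> - X 0 \<omega>))) \<partial>M) = (\<integral>\<^sup>+y. ennreal (exp (lam * norm y)) \<partial>Y t)"
      unfolding Y_def using t by (subst nn_integral_distr) auto
    also have "\<dots> \<le> ennreal (K * exp (L.growth_rate b * t))" by (rule K[OF t(1)])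
    also have "K * exp (L.growth_rate b * t) \<le> \<bar>K\<bar> * exp (\<bar>L.growth_rate b\<bar> * T)"
    proof -
      have "L.growth_rate b * t \<le> \<bar>L.growth_rate b\<bar> * T" using t by (intro mult_mono) auto
      then show ?thesis by (intro mult_mono) auto
    qed
    also have "\<dots> \<le> C" by (simp add: C_def)
    finally show ?thesis by (simp add: ennreal_leI)
  qed
  have "0 < C" by (simp add: C_def add_pos_nonneg)
  moreover have "\<P>(\<omega> in M. norm (X T \<omega> - X 0 \<omega>) \<le> 2 * r) < 1"
  proof -
    have "measure (Y T) (cball 0 (2 * r)) = \<P>(\<omega> in M. norm (X T \<omega> - X 0 \<omega>) \<le> 2 * r)"
      unfolding Y_def using T by (subst measure_distr) (auto intro!: arg_cong[where f = "measure M"])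
    then show ?thesis using escape by simp
  qed
  ultimately show ?thesis
    using integrable_exp_norm_exit_position[OF assms(3,7) T _ moment _ assms(8)] by blast
qed

end
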